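(* Let $L>0$ and let $F:\mathcal{P}_2(\mathbb{R}^d)\to\mathbb{R}$ be a functional that is Wasserstein differentiable at every $\rho\in\mathcal{P}_2(\mathbb{R}^d)$ and satisfies $$\|\nabla_{W_2}F[\rho_0](x)-\nabla_{W_2}F[\rho_1](y)\|_2\le \frac{L}{2}\bigl(\|x-y\|_2+W_2(\rho_0,\rho_1)\bigr)\qquad\text{for all }\rho_0,\rho_1\in\mathcal{P}_2(\mathbb{R}^d),\ x,y\in\mathbb{R}^d.$$ Let $m_F=\min_{\rho\in\mathcal{P}_2(\mathbb{R}^d)}F[\rho]$ (the minimum being attained). Let $\rho_0\in\mathcal{P}_2(\mathbb{R}^d)$ and let $\{\rho_k\}_{k\ge0}\subset\mathcal{P}_2(\mathbb{R}^d)$ be the sequence of position marginals $\rho_k=\mu_k^X$ generated by the measure-level Nesterov iteration defined in the context. (i) If $F$ is $m$-strongly geodesically convex for some $m>0$, and the strongly convex parameters $s=\frac1L$, $\beta_k=\frac{1-\sqrt{ms}}{1+\sqrt{ms}}$ are used, then $$F[\rho_k]-m_F\le\mathcal{O}\!\left(\left(1-\sqrt{\frac mL}\right)^k\right),$$ i.e. there is a constant $C\ge0$ independent of $k$ with $F[\rho_k]-m_F\le C\left(1-\sqrt{m/L}\right)^k$ for all $k\ge0$. (ii) If $F$ is geodesically convex ($m=0$), and the convex parameters $s=\frac1L$, $\kappa_0=1$, $\kappa_{k+1}=\frac{1+\sqrt{1+4\kappa_k^2}}{2}$, $\beta_k=\frac{\kappa_k-1}{\kappa_{k+1}}$ are used,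 then $$F[\rho_k]-m_F\le\mathcal{O}\!\left(\frac1{k^2}\right),$$ i.e. there is a constant $C\ge0$ independent of $k$ with $F[\rho_k]-m_F\le C/k^2$ for all $k\ge1$.
   Context: $\mathcal{P}_2(\mathbb{R}^n)$ is the set of Borel probability measures on $\mathbb{R}^n$ with finite second moment, $W_2$ is the Wasserstein-2 distance, $\Pi_0(\rho_0,\rho_1)$ is the set of optimal couplings for $W_2(\rho_0,\rho_1)$, and $T_\#\nu$ is the pushforward of $\nu$ by $T$. The optimization problem is $m_F=\min_{\rho\in\mathcal{P}_2(\mathbb{R}^d)}F[\rho]$, where $m_F$ denotes the minimum value. Wasserstein gradient: $F:\mathcal{P}_2(\mathbb{R}^d)\to\mathbb{R}$ is Wasserstein differentiable at $\rho$ if there is a vector field $\xi\in L^2(\rho)=\{\xi:\mathbb{R}^d\to\mathbb{R}^d:\int\|\xi\|_2^2\,d\rho<\infty\}$ such that for every $\eta\in\mathcal{P}_2(\mathbb{R}^d)$ and some optimal coupling $\gamma\in\Pi_0(\rho,\eta)$, $$F[\eta]-F[\rho]=\int_{\mathbb{R}^d\times\mathbb{R}^d}\xi(x)\cdot(y-x)\,d\gamma(x,y)+o(W_2(\rho,\eta)).$$ The field $\xi$ of minimal $L^2(\rho)$-norm with this property is the Wasserstein gradient $\nabla_{W_2}F[\rho]$. In the pointwise Lipschitz-type condition and in the iteration, $\nabla_{W_2}F[\rho]$ is understood as a map defined on all of $\mathbb{R}^d$. Geodesic convexity: for $m\ge 0$, $F$ is $m$-geodesically convex ($m$-strongly geodesically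 convex if $m>0$, geodesically convex if $m=0$) if for all $\rho_0,\rho_1\in\mathcal{P}_2(\mathbb{R}^d)$ and every $\gamma\in\Pi_0(\rho_0,\rho_1)$, $$F[\rho_t]\le(1-t)F[\rho_0]+tF[\rho_1]-\frac m2 t(1-t)W_2^2(\rho_0,\rho_1),\qquad t\in[0,1],$$ where $\rho_t=(T_t)_\#\gamma$, $T_t(x,y)=(1-t)x+ty$. Measure-level Nesterov iteration: for $\mu\in\mathcal{P}_2(\mathbb{R}^d\times\mathbb{R}^d)$, with points written $(x,v)$, let $\mu^X$ denote its first ($x$-)marginal. Initialize $\mu_0=\rho_0\otimes\delta_0$. For $k\ge1$ set $\hat\mu_k=(T_k^{\mathrm{N,drift}})_\#\mu_{k-1}$ and $\mu_k=(T_k^{\mathrm{N,momentum}})_\#\hat\mu_k$, where $$T_k^{\mathrm{N,drift}}(x,v)=\bigl(x+\sqrt s(1+\beta_k)v,\;v\bigr),$$ $$T_k^{\mathrm{N,momentum}}(x,v)=\bigl(x-\sqrt s\,\beta_k v,\;-\sqrt s\,\nabla_{W_2}F[\hat\rho_k](x)+\beta_k v\bigr),\qquad \hat\rho_k=\hat\mu_k^X .$$ The iterates are $\rho_k=\mu_k^X$. *)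

theory Defs
  imports "HOL-Probability.Probability"
begin

definition P2 :: "'a::euclidean_space measure set" where
  "P2 = {M. prob_space M \<and> sets M = sets borel \<and> integrable M (\<lambda>x. (norm x)\<^sup>2)}"

definition couplings ::
  "'a::euclidean_space measure \<Rightarrow> 'a measure \<Rightarrow> ('a \<times> 'a) measure set" where
  "couplings \<mu> \<nu> = {\<gamma>. prob_space \<gamma> \<and> sets \<gamma> = sets borel \<and>
     distr \<gamma> borel fst = \<mu> \<and> distr \<gamma> borel snd = \<nu>}"

(* The Bochner integral is 0 for a non-integrable function, but couplings of two
   measures in P2 always have finite quadratic cost; transport_cost and W2 are only
   meaningful on P2. *)
definition transport_cost :: "('a::euclidean_space \<times> 'a) measure \<Rightarrow> real" where
  "transport_cost \<gamma> = (\<integral>z. (norm (fst z - snd z))\<^sup>2 \<partial>\<gamma>)"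

definition W2 :: "'a::euclidean_space measure \<Rightarrow> 'a measure \<Rightarrow> real" where
  "W2 \<mu> \<nu> = sqrt (INF \<gamma>\<in>couplings \<mu> \<nu>. transport_cost \<gamma>)"

definition optimal_couplings ::
  "'a::euclidean_space measure \<Rightarrow> 'a measure \<Rightarrow> ('a \<times> 'a) measure set" where
  "optimal_couplings \<mu> \<nu> = {\<gamma> \<in> couplings \<mu> \<nu>. transport_cost \<gamma> = (W2 \<mu> \<nu>)\<^sup>2}"

definition L2_fields :: "'a::euclidean_space measure \<Rightarrow> ('a \<Rightarrow> 'a) set" where
  "L2_fields \<rho> = {\<xi>. \<xi> \<in> borel_measurable borel \<and> integrable \<rho> (\<lambda>x. (norm (\<xi> x))\<^sup>2)}"

(* \<Gamma> selects, for each \<eta>, the optimal coupling for which the first-order expansion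
   holds; the o(W2 \<rho> \<eta>) remainder is taken as \<eta> tends to \<rho> in W2. *)
definition wasserstein_differentials ::
  "('a::euclidean_space measure \<Rightarrow> real) \<Rightarrow> 'a measure \<Rightarrow> ('a \<Rightarrow> 'a) set" where
  "wasserstein_differentials F \<rho> = {\<xi> \<in> L2_fields \<rho>.
     \<exists>\<Gamma>. (\<forall>\<eta>\<in>P2. \<Gamma> \<eta> \<in> optimal_couplings \<rho> \<eta>) \<and>
       (\<forall>\<epsilon>>0. \<exists>\<delta>>0. \<forall>\<eta>\<in>P2. W2 \<rho> \<eta> < \<delta> \<longrightarrow>
          \<bar>F \<eta> - F \<rho> - (\<integral>z. \<xi> (fst z) \<bullet> (snd z - fst z) \<partial>\<Gamma> \<eta>)\<bar> \<le> \<epsilon> * W2 \<rho> \<eta>)}"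

definition wasserstein_differentiable ::
  "('a::euclidean_space measure \<Rightarrow> real) \<Rightarrow> 'a measure \<Rightarrow> bool" where
  "wasserstein_differentiable F \<rho> \<longleftrightarrow> wasserstein_differentials F \<rho> \<noteq> {}"

(* A predicate rather than a function, since the gradient is an element of L2(\<rho>) and its
   everywhere-defined representative is a matter of choice. *)
definition is_wasserstein_gradient ::
  "('a::euclidean_space measure \<Rightarrow> real) \<Rightarrow> 'a measure \<Rightarrow> ('a \<Rightarrow> 'a) \<Rightarrow> bool" where
  "is_wasserstein_gradient F \<rho> \<xi> \<longleftrightarrow> \<xi> \<in> wasserstein_differentials F \<rho> \<and>
     (\<forall>\<zeta>\<in>wasserstein_differentials F \<rho>.
        sqrt (\<integral>x. (norm (\<xi> x))\<^sup>2 \<partial>\<rho>) \<le> sqrt (\<integral>x. (norm (\<zeta> x))\<^sup>2 \<partial>\<rho>))"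

definition geodesically_convex ::
  "real \<Rightarrow> ('a::euclidean_space measure \<Rightarrow> real) \<Rightarrow> bool" where
  "geodesically_convex m F \<longleftrightarrow>
     (\<forall>\<rho>\<^sub>0\<in>P2. \<forall>\<rho>\<^sub>1\<in>P2. \<forall>\<gamma>\<in>optimal_couplings \<rho>\<^sub>0 \<rho>\<^sub>1. \<forall>t\<in>{0..1}.
        F (distr \<gamma> borel (\<lambda>(x, y). (1 - t) *\<^sub>R x + t *\<^sub>R y))
          \<le> (1 - t) * F \<rho>\<^sub>0 + t * F \<rho>\<^sub>1 - m / 2 * t * (1 - t) * (W2 \<rho>\<^sub>0 \<rho>\<^sub>1)\<^sup>2)"

definition nesterov_drift :: "real \<Rightarrow> real \<Rightarrow> 'a \<times> 'a \<Rightarrow> 'a::euclidean_space \<times> 'a" where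
  "nesterov_drift s b = (\<lambda>(x, v). (x + (sqrt s * (1 + b)) *\<^sub>R v, v))"

definition nesterov_momentum ::
  "real \<Rightarrow> real \<Rightarrow> ('a \<Rightarrow> 'a) \<Rightarrow> 'a \<times> 'a \<Rightarrow> 'a::euclidean_space \<times> 'a" where
  "nesterov_momentum s b g =
     (\<lambda>(x, v). (x - (sqrt s * b) *\<^sub>R v, - (sqrt s *\<^sub>R g x) + b *\<^sub>R v))"

definition nesterov_step ::
  "('a measure \<Rightarrow> 'a \<Rightarrow> 'a) \<Rightarrow> real \<Rightarrow> real \<Rightarrow> ('a \<times> 'a) measure \<Rightarrow>
     ('a::euclidean_space \<times> 'a) measure" where
  "nesterov_step G s b \<mu> =
     (let \<mu>h = distr \<mu> borel (nesterov_drift s b);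
          \<rho>h = distr \<mu>h borel fst
      in distr \<mu>h borel (nesterov_momentum s b (G \<rho>h)))"

primrec nesterov ::
  "('a measure \<Rightarrow> 'a \<Rightarrow> 'a) \<Rightarrow> real \<Rightarrow> (nat \<Rightarrow> real) \<Rightarrow> 'a measure \<Rightarrow> nat \<Rightarrow>
     ('a::euclidean_space \<times> 'a) measure" where
  "nesterov G s \<beta> \<rho>\<^sub>0 0 = \<rho>\<^sub>0 \<Otimes>\<^sub>M return borel 0"
| "nesterov G s \<beta> \<rho>\<^sub>0 (Suc k) = nesterov_step G s (\<beta> (Suc k)) (nesterov G s \<beta> \<rho>\<^sub>0 k)"

definition nesterov_position ::
  "('a measure \<Rightarrow> 'a \<Rightarrow> 'a) \<Rightarrow> real \<Rightarrow> (nat \<Rightarrow> real) \<Rightarrow> 'a measure \<Rightarrow> nat \<Rightarrow>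
     'a::euclidean_space measure" where
  "nesterov_position G s \<beta> \<rho>\<^sub>0 k = distr (nesterov G s \<beta> \<rho>\<^sub>0 k) borel fst"

definition \<beta>_strong :: "real \<Rightarrow> real \<Rightarrow> nat \<Rightarrow> real" where
  "\<beta>_strong m s k = (1 - sqrt (m * s)) / (1 + sqrt (m * s))"

primrec \<kappa> :: "nat \<Rightarrow> real" where
  "\<kappa> 0 = 1"
| "\<kappa> (Suc k) = (1 + sqrt (1 + 4 * (\<kappa> k)\<^sup>2)) / 2"

definition \<beta>_convex :: "nat \<Rightarrow> real" where
  "\<beta>_convex k = (\<kappa> k - 1) / \<kappa> (Suc k)"

end

theory Submission
  imports Defs
begin

text \<open>Lift \<open>F\<close> to square integrable random variables through their law. For finitely valued \<open>X\<close> and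
  \<open>V\<close> and small \<open>h\<close>, the joint law of \<open>X\<close> and \<open>X + h V\<close> is the only optimal coupling of its marginals.
  Hence \<open>t \<mapsto> F (law (X + t V))\<close> is differentiable with derivative \<open>E[G(X + t V) \<bullet> V]\<close>, which is
  Lipschitz in \<open>t\<close>, and geodesic convexity becomes a local tangent inequality at every \<open>t\<close>; for a
  differentiable function on the line local support lines are global. Density of finitely valued
  variables yields the descent inequality and (strong) convexity along arbitrary couplings. The
  iteration is then Nesterov's method in \<open>L\<^sup>2(\<rho>\<^sub>0 \<Otimes> \<rho>s)\<close> with \<open>\<rho>s\<close> a minimiser, started with zero
  momentum, and the classical Lyapunov functions apply. In the strongly convex case the pointwise
  Lipschitz bound forces \<open>m \<le> L / 2\<close>; this is needed because the first step does not move, so for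
  \<open>m = L\<close> the claim would fail.\<close>

section \<open>Square integrable random variables and couplings\<close>

text \<open>Both hypotheses on \<open>F\<close> speak about optimal couplings only, and
  differentiability about one unspecified optimal coupling. Nesterov's argument compares iterates
  with each other and with a minimiser through the joint law that the dynamics produces, and nothing
  makes this law optimal. Finitely valued variables bridge the gap: a displacement shorter than half
  the distance between atoms cannot confuse their origins, so optimality and uniqueness come for
  free, and mass sitting at one atom may still split. The admissible step depends on the separation
  of the values of \<open>X + t V\<close>, which degenerates near times where distinct values merge.
  No step size is uniform in \<open>t\<close>, so the estimates are local at each \<open>t\<close>
  and are globalised by a one-dimensional argument.

  The result is a function on a Hilbert space that is \<open>L\<close>-smooth and
  \<open>m\<close>-convex. The constant is exactly \<open>L\<close>: the displacement and the
  \<open>W2\<close> term of the Lipschitz bound contribute \<open>L / 2\<close> each after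
  integration. From there on all estimates are pointwise quadratic algebra under an
  integral.\<close>

definition square_integrable :: "'b measure \<Rightarrow> ('b \<Rightarrow> 'a::euclidean_space) \<Rightarrow> bool" where
  "square_integrable M X \<longleftrightarrow> X \<in> borel_measurable M \<and> integrable M (\<lambda>\<omega>. (norm (X \<omega>))\<^sup>2)"

abbreviation law :: "'b measure \<Rightarrow> ('b \<Rightarrow> 'a::euclidean_space) \<Rightarrow> 'a measure" where
  "law M X \<equiv> distr M borel X"

lemma square_integrableD:
  assumes "square_integrable M X"
  shows "X \<in> borel_measurable M" "integrable M (\<lambda>\<omega>. (norm (X \<omega>))\<^sup>2)"
  using assms by (auto simp: square_integrable_def)

lemma square_integrable_bound:
  assumes X: "square_integrable M X" and [measurable]: "Y \<in> borel_measurable M"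
    and bound: "\<And>\<omega>. \<omega> \<in> space M \<Longrightarrow> norm (Y \<omega>) \<le> c * norm (X \<omega>)"
  shows "square_integrable M Y"
proof -
  have int: "integrable M (\<lambda>\<omega>. c\<^sup>2 * (norm (X \<omega>))\<^sup>2)"
    using square_integrableD(2)[OF X] by simp
  have le: "(norm (Y \<omega>))\<^sup>2 \<le> c\<^sup>2 * (norm (X \<omega>))\<^sup>2" if "\<omega> \<in> space M" for \<omega>
    using power_mono[OF bound[OF that], of 2] by (simp add: power_mult_distrib)
  have "integrable M (\<lambda>\<omega>. (norm (Y \<omega>))\<^sup>2)"
    by (rule Bochner_Integration.integrable_bound[OF int]) (use le in \<open>auto intro!: AE_I2\<close>)
  then show ?thesis by (simp add: square_integrable_def)
qed

lemma square_integrable_scaleR: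
  assumes "square_integrable M X"
  shows "square_integrable M (\<lambda>\<omega>. c *\<^sub>R X \<omega>)"
  using square_integrable_bound[OF assms, of "\<lambda>\<omega>. c *\<^sub>R X \<omega>" "\<bar>c\<bar>"] square_integrableD(1)[OF assms]
  by auto

lemma square_integrable_add:
  assumes X: "square_integrable M X" and Y: "square_integrable M Y"
  shows "square_integrable M (\<lambda>\<omega>. X \<omega> + Y \<omega>)"
proof -
  note [measurable] = square_integrableD(1)[OF X] square_integrableD(1)[OF Y]
  have int: "integrable M (\<lambda>\<omega>. 2 * (norm (X \<omega>))\<^sup>2 + 2 * (norm (Y \<omega>))\<^sup>2)"
    using X Y by (auto simp: square_integrable_def)
  have le: "(norm (X \<omega> + Y \<omega>))\<^sup>2 \<le> 2 * (norm (X \<omega>))\<^sup>2 + 2 * (norm (Y \<omega>))\<^sup>2" for \<omega>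
  proof -
    have "(norm (X \<omega> + Y \<omega>))\<^sup>2 \<le> (norm (X \<omega>) + norm (Y \<omega>))\<^sup>2"
      by (intro power_mono norm_triangle_ineq) auto
    also have "\<dots> \<le> 2 * (norm (X \<omega>))\<^sup>2 + 2 * (norm (Y \<omega>))\<^sup>2"
      using sum_squares_bound[of "norm (X \<omega>)" "norm (Y \<omega>)"] by (simp add: power2_sum)
    finally show ?thesis .
  qed
  have "integrable M (\<lambda>\<omega>. (norm (X \<omega> + Y \<omega>))\<^sup>2)"
    by (rule Bochner_Integration.integrable_bound[OF int]) (use le in \<open>auto intro!: AE_I2\<close>)
  then show ?thesis by (simp add: square_integrable_def)
qed

lemma square_integrable_diff:
  assumes "square_integrable M X" and "square_integrable M Y"
  shows "square_integrable M (\<lambda>\<omega>. X \<omega> - Y \<omega>)"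
  using square_integrable_add[OF assms(1) square_integrable_scaleR[OF assms(2), of "-1"]] by simp

lemmas square_integrable_intros =
  square_integrable_add square_integrable_diff square_integrable_scaleR

lemma square_integrable_const:
  assumes "finite_measure M"
  shows "square_integrable M (\<lambda>\<omega>. c)"
proof -
  interpret finite_measure M by fact
  show ?thesis by (simp add: square_integrable_def)
qed

lemma square_integrable_inner:
  assumes X: "square_integrable M X" and Y: "square_integrable M Y"
  shows "integrable M (\<lambda>\<omega>. X \<omega> \<bullet> Y \<omega>)"
proof -
  note [measurable] = square_integrableD(1)[OF X] square_integrableD(1)[OF Y]
  have int: "integrable M (\<lambda>\<omega>. (norm (X \<omega>))\<^sup>2 + (norm (Y \<omega>))\<^sup>2)"
    using X Y by (auto simp: square_integrable_def)
  have le: "\<bar>X \<omega> \<bullet> Y \<omega>\<bar> \<le> (norm (X \<omega>))\<^sup>2 + (norm (Y \<omega>))\<^sup>2" for \<omega>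
  proof -
    have "\<bar>X \<omega> \<bullet> Y \<omega>\<bar> \<le> norm (X \<omega>) * norm (Y \<omega>)" by (rule Cauchy_Schwarz_ineq2)
    also have "\<dots> \<le> 2 * norm (X \<omega>) * norm (Y \<omega>)"
      by (simp add: mult_le_cancel_right1)
    also have "\<dots> \<le> (norm (X \<omega>))\<^sup>2 + (norm (Y \<omega>))\<^sup>2"
      using sum_squares_bound[of "norm (X \<omega>)" "norm (Y \<omega>)"] by simp
    finally show ?thesis .
  qed
  show ?thesis
    by (rule Bochner_Integration.integrable_bound[OF int]) (use le in \<open>auto intro!: AE_I2\<close>)
qed

lemma simple_function_square_integrable:
  fixes X :: "'b \<Rightarrow> 'a::euclidean_space"
  assumes "finite_measure M" and X: "simple_function M X"
  shows "square_integrable M X"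
proof -
  interpret finite_measure M by fact
  have [measurable]: "X \<in> borel_measurable M"
    using X by (rule borel_measurable_simple_function)
  have "finite (X ` space M)" using X by (simp add: simple_function_def)
  then obtain B where "\<And>\<omega>. \<omega> \<in> space M \<Longrightarrow> norm (X \<omega>) \<le> B"
    using finite_imp_bounded bounded_iff by (metis image_eqI)
  then have "\<And>\<omega>. \<omega> \<in> space M \<Longrightarrow> (norm (X \<omega>))\<^sup>2 \<le> B\<^sup>2" by (auto intro!: power_mono)
  then have "integrable M (\<lambda>\<omega>. (norm (X \<omega>))\<^sup>2)"
    by (intro integrable_const_bound[where B="B\<^sup>2"]) auto
  then show ?thesis by (simp add: square_integrable_def)
qed

section \<open>Laws of random variables, their couplings and the transport cost\<close>

lemma fst_borel [measurable]: "fst \<in> borel_measurable (borel :: ('a::euclidean_space \<times> 'a) measure)"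
  and snd_borel [measurable]: "snd \<in> borel_measurable (borel :: ('a::euclidean_space \<times> 'a) measure)"
  by (auto intro!: borel_measurable_continuous_onI continuous_intros)

lemma square_integrable_law_iff:
  assumes [measurable]: "X \<in> borel_measurable M" "f \<in> borel_measurable borel"
  shows "square_integrable (law M X) f \<longleftrightarrow> square_integrable M (\<lambda>\<omega>. f (X \<omega>))"
  by (simp add: square_integrable_def integrable_distr_eq)

lemma law_in_P2:
  assumes "prob_space M" and X: "square_integrable M X"
  shows "law M X \<in> P2"
proof -
  interpret prob_space M by fact
  note [measurable] = square_integrableD(1)[OF X]
  show ?thesis using square_integrableD(2)[OF X]
    by (simp add: P2_def integrable_distr_eq prob_space_distr)
qed

lemma P2_square_integrable_id:
  assumes "\<rho> \<in> P2" shows "square_integrable \<rho> (\<lambda>x. x)"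
proof -
  have s: "sets \<rho> = sets borel" using assms by (simp add: P2_def)
  have "(\<lambda>x. x) \<in> borel_measurable \<rho>" using s by (simp add: measurable_cong_sets[OF s refl])
  then show ?thesis using assms by (auto simp: P2_def square_integrable_def)
qed

lemma coupling_law:
  assumes "prob_space M" and [measurable]: "X \<in> borel_measurable M" "Y \<in> borel_measurable M"
  shows "law M (\<lambda>\<omega>. (X \<omega>, Y \<omega>)) \<in> couplings (law M X) (law M Y)"
proof -
  interpret prob_space M by fact
  show ?thesis
    by (simp add: couplings_def prob_space_distr distr_distr comp_def)
qed

lemma transport_cost_nonneg: "0 \<le> transport_cost \<gamma>"
  by (simp add: transport_cost_def)

lemma transport_cost_law:
  assumes [measurable]: "X \<in> borel_measurable M" "Y \<in> borel_measurable M"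
  shows "transport_cost (law M (\<lambda>\<omega>. (X \<omega>, Y \<omega>))) = (\<integral>\<omega>. (norm (X \<omega> - Y \<omega>))\<^sup>2 \<partial>M)"
  by (simp add: transport_cost_def integral_distr)

lemma W2_le_transport_cost:
  assumes "\<gamma> \<in> couplings \<mu> \<nu>"
  shows "W2 \<mu> \<nu> \<le> sqrt (transport_cost \<gamma>)"
  unfolding W2_def using assms
  by (intro real_sqrt_le_mono cINF_lower) (auto intro!: bdd_belowI[where m=0] transport_cost_nonneg)

lemma W2_law_le:
  assumes "prob_space M" and "X \<in> borel_measurable M" "Y \<in> borel_measurable M"
  shows "W2 (law M X) (law M Y) \<le> sqrt (\<integral>\<omega>. (norm (X \<omega> - Y \<omega>))\<^sup>2 \<partial>M)"
  using W2_le_transport_cost[OF coupling_law[OF assms]] transport_cost_law[OF assms(2,3)] by simp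

lemma W2_nonneg_of_coupling:
  assumes "couplings \<mu> \<nu> \<noteq> {}"
  shows "0 \<le> W2 \<mu> \<nu>"
  unfolding W2_def using assms by (simp add: cINF_greatest transport_cost_nonneg)

lemma W2_eqI:
  assumes "\<gamma> \<in> couplings \<mu> \<nu>"
    and "\<And>\<gamma>'. \<gamma>' \<in> couplings \<mu> \<nu> \<Longrightarrow> transport_cost \<gamma> \<le> transport_cost \<gamma>'"
  shows "(W2 \<mu> \<nu>)\<^sup>2 = transport_cost \<gamma>"
proof -
  have "(INF \<gamma>\<in>couplings \<mu> \<nu>. transport_cost \<gamma>) = transport_cost \<gamma>"
    using assms by (intro cInf_eq_minimum) auto
  then show ?thesis by (simp add: W2_def transport_cost_nonneg)
qed

text \<open>If \<open>X\<close> has finitely many well separated values and \<open>Y\<close> is closer to \<open>X\<close> than half their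
  distance, then the value of \<open>X\<close> can be read off from \<open>Y\<close> as the nearest atom.\<close>

lemma optimal_couplings_small_displacement:
  fixes X Y :: "'b \<Rightarrow> 'a::euclidean_space"
  assumes M: "prob_space M" and X: "simple_function M X" and [measurable]: "Y \<in> borel_measurable M"
    and sep: "\<And>a b. a \<in> X ` space M \<Longrightarrow> b \<in> X ` space M \<Longrightarrow> a \<noteq> b \<Longrightarrow> 2 * r \<le> dist a b"
    and near: "\<And>\<omega>. \<omega> \<in> space M \<Longrightarrow> dist (X \<omega>) (Y \<omega>) < r"
  shows "optimal_couplings (law M X) (law M Y) = {law M (\<lambda>\<omega>. (X \<omega>, Y \<omega>))}"
proof -
  interpret M: prob_space M by fact
  have [measurable]: "X \<in> borel_measurable M"
    using X by (rule borel_measurable_simple_function)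
  define S where "S = X ` space M"
  have fin: "finite S" using X by (simp add: S_def simple_function_def)
  \<comment> \<open>The open balls of radius \<open>r\<close> around the atoms are disjoint, so at
    most one summand is nonzero and \<open>n\<close> picks the atom near \<open>y\<close>. Away from
    the balls \<open>n\<close> is 0; this is harmless, since the second marginal of every coupling
    lives on their union.\<close>
  define n where "n y = (\<Sum>s\<in>S. indicator (ball s r) y *\<^sub>R s)" for y
  have n_meas [measurable]: "n \<in> borel_measurable borel"
    unfolding n_def by (intro borel_measurable_sum borel_measurable_scaleR borel_measurable_indicator) auto
  have far: "dist y s' > r" if "s \<in> S" "s' \<in> S" "s' \<noteq> s" "dist s y < r" for s s' y
    using sep[of s s'] dist_triangle[of s s' y] that by (auto simp: S_def dist_commute)
  have n_eq: "n y = s" if "s \<in> S" "dist s y < r" for s y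
  proof -
    have "n y = (\<Sum>s'\<in>S. if s' = s then s else 0)"
      unfolding n_def using far[OF that(1) _ _ that(2)] that(2)
      by (intro sum.cong refl) (force simp: indicator_def dist_commute)
    then show ?thesis using fin that by simp
  qed
  let ?\<gamma> = "law M (\<lambda>\<omega>. (X \<omega>, Y \<omega>))"
  have \<gamma>0: "?\<gamma> \<in> couplings (law M X) (law M Y)"
    using M by (rule coupling_law) measurable
  obtain B where B: "\<And>s. s \<in> S \<Longrightarrow> norm s \<le> B"
    using fin finite_imp_bounded bounded_iff by metis
  \<comment> \<open>The cost of any coupling dominates the integral of the squared distance of
    \<open>y\<close> to its nearest atom. That integral sees the second marginal only, so it is the
    same for all couplings, and the given one attains it. Equality forces \<open>x = n y\<close>
    almost everywhere: the coupling is a graph over its second coordinate, which permits an atom of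
    \<open>X\<close> to split.\<close>
  have cmp: "transport_cost ?\<gamma> \<le> transport_cost \<gamma> \<and> (transport_cost \<gamma> = transport_cost ?\<gamma> \<longrightarrow> \<gamma> = ?\<gamma>)"
    if \<gamma>: "\<gamma> \<in> couplings (law M X) (law M Y)" for \<gamma>
  proof -
    interpret G: prob_space \<gamma> using \<gamma> by (simp add: couplings_def)
    have sets [measurable_cong]: "sets \<gamma> = sets borel" and
      mX: "law \<gamma> fst = law M X" and mY: "law \<gamma> snd = law M Y" using \<gamma> by (auto simp: couplings_def)
    have fs[measurable]: "fst \<in> borel_measurable \<gamma>" "snd \<in> borel_measurable \<gamma>"
      by measurable
    have "AE x in law M X. x \<in> S"
      using fin by (subst AE_distr_iff) (auto simp: S_def intro!: borel_closed finite_imp_closed)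
    then have "AE x in law \<gamma> fst. x \<in> S" unfolding mX .
    then have AE1: "AE z in \<gamma>. fst z \<in> S"
      using fin by (subst (asm) AE_distr_iff) (auto simp: intro!: borel_closed finite_imp_closed)
    define U where "U = (\<Union>s\<in>S. ball s r)"
    have [measurable]: "U \<in> sets borel" unfolding U_def by (intro borel_open open_UN) auto
    have "AE y in law M Y. y \<in> U"
    proof (subst AE_distr_iff)
      show "AE \<omega> in M. Y \<omega> \<in> U"
        using near by (intro AE_I2) (auto simp: U_def S_def)
    qed auto
    then have "AE y in law \<gamma> snd. y \<in> U" unfolding mY .
    then have AE2: "AE z in \<gamma>. snd z \<in> U"
      by (subst (asm) AE_distr_iff) auto
    define c where "c z = (norm (fst z - snd z))\<^sup>2" for z :: "'a \<times> 'a"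
    define c' where "c' z = (norm (n (snd z) - snd z))\<^sup>2" for z :: "'a \<times> 'a"
    have [measurable]: "c \<in> borel_measurable borel" "c' \<in> borel_measurable borel"
      unfolding c_def c'_def by measurable
    \<comment> \<open>The last conjunct serves integrability: both marginals are bounded, so the
      costs are bounded almost everywhere and their integrals may be compared.\<close>
    have le: "AE z in \<gamma>. c' z \<le> c z \<and> (c' z = c z \<longrightarrow> fst z = n (snd z)) \<and> c z \<le> (2 * B + r)\<^sup>2"
      using AE1 AE2
    proof eventually_elim
      case (elim z)
      then obtain s where s: "s \<in> S" "dist s (snd z) < r" by (auto simp: U_def)
      have ny: "n (snd z) = s" using n_eq s by simp
      have "norm (fst z - snd z) \<le> norm (fst z) + norm s + norm (s - snd z)"
        using norm_triangle_ineq4[of "fst z" s] norm_triangle_ineq[of "fst z - s" "s - snd z"] by simp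
      also have "\<dots> \<le> 2 * B + r" using B[of s] B[of "fst z"] s elim by (simp add: dist_norm)
      finally have b: "c z \<le> (2 * B + r)\<^sup>2" unfolding c_def by (intro power_mono) auto
      show ?case
      proof (cases "fst z = s")
        case True
        then show ?thesis using b ny by (simp add: c_def c'_def)
      next
        case False
        then have "dist (snd z) (fst z) > r" using far[OF s(1) elim(1) _ s(2)] by simp
        then have "norm (s - snd z) < norm (fst z - snd z)" using s(2)
          by (simp add: dist_norm norm_minus_commute)
        then have "c' z < c z" unfolding c_def c'_def ny by (intro power_strict_mono) auto
        then show ?thesis using b by simp
      qed
    qed
    have int_c: "integrable \<gamma> c"
      using le by (intro G.integrable_const_bound[where B="(2 * B + r)\<^sup>2"]) (auto simp: c_def)
    have int_c': "integrable \<gamma> c'"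
      using le by (intro G.integrable_const_bound[where B="(2 * B + r)\<^sup>2"]) (auto simp: c'_def)
    have nX: "n (Y \<omega>) = X \<omega>" if "\<omega> \<in> space M" for \<omega>
      using n_eq[of "X \<omega>" "Y \<omega>"] near that by (simp add: S_def)
    have "(\<integral>z. c' z \<partial>\<gamma>) = (\<integral>y. (norm (n y - y))\<^sup>2 \<partial>law \<gamma> snd)"
      by (simp add: c'_def integral_distr)
    also have "\<dots> = (\<integral>\<omega>. (norm (n (Y \<omega>) - Y \<omega>))\<^sup>2 \<partial>M)"
      by (simp add: mY integral_distr)
    also have "\<dots> = (\<integral>\<omega>. (norm (X \<omega> - Y \<omega>))\<^sup>2 \<partial>M)"
      using nX by (intro Bochner_Integration.integral_cong) auto
    also have "\<dots> = transport_cost ?\<gamma>" by (simp add: transport_cost_law)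
    finally have c'_eq: "(\<integral>z. c' z \<partial>\<gamma>) = transport_cost ?\<gamma>" .
    have c_eq: "(\<integral>z. c z \<partial>\<gamma>) = transport_cost \<gamma>" by (simp add: c_def transport_cost_def)
    have "(\<integral>z. c' z \<partial>\<gamma>) \<le> (\<integral>z. c z \<partial>\<gamma>)"
      using le by (intro integral_mono_AE int_c int_c') auto
    moreover have "\<gamma> = ?\<gamma>" if eq: "transport_cost \<gamma> = transport_cost ?\<gamma>"
    proof -
      have "(\<integral>z. c z - c' z \<partial>\<gamma>) = 0" using eq c_eq c'_eq int_c int_c' by simp
      moreover have "AE z in \<gamma>. 0 \<le> c z - c' z" using le by auto
      ultimately have "AE z in \<gamma>. c z - c' z = 0"
        using integral_nonneg_eq_0_iff_AE[of \<gamma> "\<lambda>z. c z - c' z"] int_c int_c' by simp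
      then have AEn: "AE z in \<gamma>. z = (n (snd z), snd z)" using le by eventually_elim (auto simp: prod_eq_iff)
      have "\<gamma> = distr \<gamma> borel (\<lambda>z. z)" using sets by (simp add: distr_id2)
      also have "\<dots> = distr \<gamma> borel (\<lambda>z. (n (snd z), snd z))"
        using AEn by (intro distr_cong_AE) auto
      also have "\<dots> = distr (law \<gamma> snd) borel (\<lambda>y. (n y, y))"
        by (simp add: distr_distr comp_def)
      also have "\<dots> = distr M borel (\<lambda>\<omega>. (n (Y \<omega>), Y \<omega>))"
        by (simp add: distr_distr comp_def mY)
      also have "\<dots> = ?\<gamma>" using nX by (intro distr_cong) auto
      finally show ?thesis .
    qed
    ultimately show ?thesis using c_eq c'_eq by simp
  qed
  have "(W2 (law M X) (law M Y))\<^sup>2 = transport_cost ?\<gamma>"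
    using \<gamma>0 cmp by (intro W2_eqI) auto
  then show ?thesis using \<gamma>0 cmp by (auto simp: optimal_couplings_def)
qed

lemma finite_separation:
  fixes S :: "'a::metric_space set"
  assumes "finite S"
  obtains r where "r > 0" "\<And>a b. a \<in> S \<Longrightarrow> b \<in> S \<Longrightarrow> a \<noteq> b \<Longrightarrow> 2 * r \<le> dist a b"
proof -
  \<comment> \<open>The extra element 1 keeps the set nonempty when \<open>S\<close> has at most one
    point.\<close>
  define D where "D = insert 1 ((\<lambda>(a, b). dist a b) ` {p \<in> S \<times> S. fst p \<noteq> snd p})"
  have fin: "finite D" using assms by (simp add: D_def)
  have "Min D > 0" using fin by (subst Min_gr_iff) (auto simp: D_def)
  moreover have "Min D \<le> dist a b" if "a \<in> S" "b \<in> S" "a \<noteq> b" for a b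
    using that fin by (intro Min_le) (force simp: D_def)+
  ultimately show ?thesis by (intro that[of "Min D / 2"]) auto
qed

text \<open>A bound \<open>B\<close> on \<open>V\<close> turns \<open>\<bar>h\<bar> < r / B\<close>
  into a displacement below the separation radius \<open>r\<close> of the values of
  \<open>X\<close>. Negative \<open>h\<close> is allowed, which gives two-sided derivatives.
  \<open>V\<close> need not be a function of \<open>X\<close>.\<close>

lemma optimal_couplings_small_step:
  fixes X V :: "'b \<Rightarrow> 'a::euclidean_space"
  assumes M: "prob_space M" and X: "simple_function M X" and V: "simple_function M V"
  obtains d where "d > 0"
    and "\<And>h. \<bar>h\<bar> < d \<Longrightarrow> optimal_couplings (law M X) (law M (\<lambda>\<omega>. X \<omega> + h *\<^sub>R V \<omega>))
           = {law M (\<lambda>\<omega>. (X \<omega>, X \<omega> + h *\<^sub>R V \<omega>))}"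
proof -
  have [measurable]: "X \<in> borel_measurable M" "V \<in> borel_measurable M"
    using X V by (auto intro: borel_measurable_simple_function)
  have "finite (X ` space M)" using X by (simp add: simple_function_def)
  then obtain r where r: "r > 0"
    "\<And>a b. a \<in> X ` space M \<Longrightarrow> b \<in> X ` space M \<Longrightarrow> a \<noteq> b \<Longrightarrow> 2 * r \<le> dist a b"
    using finite_separation by metis
  have "finite (V ` space M)" using V by (simp add: simple_function_def)
  then obtain B where B: "\<And>\<omega>. \<omega> \<in> space M \<Longrightarrow> norm (V \<omega>) \<le> B" and "B > 0"
    using finite_imp_bounded bounded_pos by (metis image_eqI)
  show ?thesis
  proof (rule that[of "r / B"])
    show "r / B > 0" using r \<open>B > 0\<close> by simp
    fix h :: real assume h: "\<bar>h\<bar> < r / B"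
    show "optimal_couplings (law M X) (law M (\<lambda>\<omega>. X \<omega> + h *\<^sub>R V \<omega>))
           = {law M (\<lambda>\<omega>. (X \<omega>, X \<omega> + h *\<^sub>R V \<omega>))}"
    proof (rule optimal_couplings_small_displacement[OF M X, where r=r])
      fix \<omega> assume "\<omega> \<in> space M"
      then have "\<bar>h\<bar> * norm (V \<omega>) \<le> \<bar>h\<bar> * B" using B by (intro mult_left_mono) auto
      also have "\<dots> < r" using h \<open>B > 0\<close> by (simp add: field_simps)
      finally show "dist (X \<omega>) (X \<omega> + h *\<^sub>R V \<omega>) < r" by (simp add: dist_norm)
    qed (use r in auto)
  qed
qed

section \<open>Local support on the real line\<close>

text \<open>At the last maximum of \<open>f\<close> minus its chord, the local tangent inequality would make the
  difference maximal also slightly further to the right.\<close>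

lemma convex_of_local_support:
  fixes f f' :: "real \<Rightarrow> real"
  assumes deriv: "\<And>t. (f has_real_derivative f' t) (at t)"
    and supp: "\<And>t. \<exists>d>0. \<forall>h. \<bar>h\<bar> < d \<longrightarrow> f t + h * f' t \<le> f (t + h)"
  shows "f 0 + f' 0 \<le> f 1"
proof -
  define q where "q t = f t - f 0 - t * (f 1 - f 0)" for t
  have q01: "q 0 = 0" "q 1 = 0" by (simp_all add: q_def)
  have dq: "(q has_real_derivative f' t - (f 1 - f 0)) (at t)" for t
    unfolding q_def by (auto intro!: derivative_eq_intros deriv)
  have cont: "continuous_on A q" for A
    using dq by (intro DERIV_continuous_on) (auto intro: has_field_derivative_at_within)
  have le0: "q t \<le> 0" if t: "t \<in> {0..1}" for t
  proof (rule ccontr)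
    assume "\<not> q t \<le> 0"
    obtain x where x: "x \<in> {0..1}" "\<And>y. y \<in> {0..1} \<Longrightarrow> q y \<le> q x"
      using continuous_attains_sup[OF compact_Icc _ cont, of 0 1] by (metis atLeastAtMost_iff empty_iff t)
    have pos: "q x > 0" using x(2)[OF t] \<open>\<not> q t \<le> 0\<close> by simp
    define A where "A = {y \<in> {0..1}. q y = q x}"
    have "A = {0..1} \<inter> q -` {q x}" by (auto simp: A_def)
    then have "closed A" using continuous_closed_preimage[OF cont[of "{0..1}"], of "{q x}"] by auto
    then have "compact ({0..1} \<inter> A)" by (intro compact_Int_closed) auto
    moreover have "{0..1} \<inter> A = A" by (auto simp: A_def)
    ultimately have "compact A" by simp
    moreover have "A \<noteq> {}" using x by (auto simp: A_def)
    ultimately obtain y where y: "y \<in> A" "\<And>z. z \<in> A \<Longrightarrow> z \<le> y"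
      using compact_attains_sup[of A] by metis
    have yx: "q y = q x" "0 \<le> y" "y \<le> 1" using y by (auto simp: A_def)
    with pos q01 have "y \<noteq> 0" "y \<noteq> 1" by auto
    with yx have y01: "0 < y" "y < 1" by auto
    \<comment> \<open>At an interior maximum the tangent of \<open>f\<close> has the slope of the
      chord, so the local support line at \<open>y\<close> is parallel to the chord and keeps
      \<open>q\<close> from falling to the right of \<open>y\<close>.\<close>
    have "f' y - (f 1 - f 0) = 0"
    proof (rule DERIV_local_max[OF dq[of y]])
      show "0 < min y (1 - y)" using y01 by simp
      show "\<forall>z. \<bar>y - z\<bar> < min y (1 - y) \<longrightarrow> q z \<le> q y"
      proof (intro allI impI)
        fix z assume "\<bar>y - z\<bar> < min y (1 - y)"
        then have "z \<in> {0..1}" by auto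
        then show "q z \<le> q y" using x(2) yx(1) by simp
      qed
    qed
    then have f'y: "f' y = f 1 - f 0" by simp
    obtain d where d: "d > 0" "\<And>h. \<bar>h\<bar> < d \<Longrightarrow> f y + h * f' y \<le> f (y + h)"
      using supp by blast
    define h where "h = min (d / 2) (1 - y)"
    have h: "0 < h" "\<bar>h\<bar> < d" "y + h \<le> 1" using d y01 by (auto simp: h_def)
    have "f y + h * (f 1 - f 0) \<le> f (y + h)" using d(2)[OF h(2)] f'y by simp
    then have "q y \<le> q (y + h)" unfolding q_def by (simp add: algebra_simps)
    moreover have "y + h \<in> {0..1}" using h y01 by simp
    ultimately have "y + h \<in> A" using x(2)[of "y + h"] yx(1) by (simp add: A_def)
    then show False using y(2)[of "y + h"] h(1) by simp
  qed
  \<comment> \<open>Since \<open>q\<close> vanishes at 0 and is nonpositive on the unit interval,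
    its slope at 0 cannot be positive; this is the tangent inequality.\<close>
  have "f' 0 - (f 1 - f 0) \<le> 0"
  proof (rule ccontr)
    assume "\<not> ?thesis"
    then obtain d where d: "d > 0" "\<And>h. 0 < h \<Longrightarrow> h < d \<Longrightarrow> q 0 < q (0 + h)"
      using DERIV_pos_inc_right[OF dq[of 0]] by (metis not_le)
    define h where "h = min (d / 2) 1"
    have "0 < h" "h < d" "h \<le> 1" using d(1) by (auto simp: h_def min_def)
    then show False using d(2)[of h] le0[of h] q01 by simp
  qed
  then show ?thesis by simp
qed

text \<open>Subtracting \<open>K * t\<^sup>2\<close> removes the quadratic term exactly, because the
  square of \<open>t + h\<close> is its tangent at \<open>t\<close> plus the square of
  \<open>h\<close>. The correction to the slope vanishes at 0, and the correction to the value at 1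
  is \<open>K\<close>.\<close>

lemma strongly_convex_of_local_support:
  fixes f f' :: "real \<Rightarrow> real"
  assumes deriv: "\<And>t. (f has_real_derivative f' t) (at t)"
    and supp: "\<And>t. \<exists>d>0. \<forall>h. \<bar>h\<bar> < d \<longrightarrow> f t + h * f' t + K * h\<^sup>2 \<le> f (t + h)"
  shows "f 0 + f' 0 + K \<le> f 1"
proof -
  define g where "g t = f t - K * t\<^sup>2" for t
  have "(g has_real_derivative f' t - 2 * K * t) (at t)" for t
    unfolding g_def by (auto intro!: derivative_eq_intros deriv)
  moreover have "\<exists>d>0. \<forall>h. \<bar>h\<bar> < d \<longrightarrow> g t + h * (f' t - 2 * K * t) \<le> g (t + h)" for t
  proof -
    have "g t + h * (f' t - 2 * K * t) \<le> g (t + h)" if "f t + h * f' t + K * h\<^sup>2 \<le> f (t + h)" for h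
      using that by (simp add: g_def power2_eq_square algebra_simps)
    then show ?thesis using supp[of t] by blast
  qed
  ultimately have "g 0 + (f' 0 - 2 * K * 0) \<le> g 1" by (rule convex_of_local_support)
  then show ?thesis by (simp add: g_def)
qed

text \<open>After subtraction of the quadratic upper model the derivative is nonpositive, so the
  remainder does not increase from 0 to 1.\<close>

lemma descent_of_derivative_bound:
  fixes f f' :: "real \<Rightarrow> real"
  assumes deriv: "\<And>t. (f has_real_derivative f' t) (at t)"
    and bound: "\<And>t. 0 \<le> t \<Longrightarrow> f' t \<le> f' 0 + 2 * K * t"
  shows "f 1 \<le> f 0 + f' 0 + K"
proof -
  define g where "g t = f t - f' 0 * t - K * t\<^sup>2" for t
  have "(g has_real_derivative f' t - f' 0 - 2 * K * t) (at t)" for t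
    unfolding g_def by (auto intro!: derivative_eq_intros deriv)
  moreover have "f' t - f' 0 - 2 * K * t \<le> 0" if "0 \<le> t" for t using bound[OF that] by simp
  ultimately have "\<exists>y. (g has_real_derivative y) (at t) \<and> y \<le> 0" if "0 \<le> t" for t
    using that by blast
  then have "g 1 \<le> g 0"
    by (intro DERIV_nonpos_imp_nonincreasing[of 0 1 g]) auto
  then show ?thesis by (simp add: g_def)
qed

text \<open>Divide the convexity inequality by \<open>t\<close> and let \<open>t\<close> tend to 0
  from the right. The endpoint \<open>h\<close> may have either sign; \<open>K\<close> absorbs the
  factor that depends on the length of the segment.\<close>

lemma support_of_strong_convexity:
  fixes f :: "real \<Rightarrow> real"
  assumes deriv: "(f has_real_derivative D) (at 0)"
    and conv: "\<And>t. 0 \<le> t \<Longrightarrow> t \<le> 1 \<Longrightarrow> f (t * h) \<le> (1 - t) * f 0 + t * f h - t * (1 - t) * K"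
  shows "f 0 + h * D + K \<le> f h"
proof -
  have "((\<lambda>t. f (t * h)) has_real_derivative D * h) (at 0)"
    using DERIV_chain2[of f D "\<lambda>t. t * h" 0 h UNIV] deriv
      DERIV_cmult_right[OF DERIV_ident, of h 0 UNIV] by simp
  then have "((\<lambda>t. (f (t * h) - f 0) / t) \<longlongrightarrow> D * h) (at 0)"
    by (simp add: DERIV_def)
  then have lim: "((\<lambda>t. (f (t * h) - f 0) / t) \<longlongrightarrow> D * h) (at_right 0)"
    by (rule tendsto_within_subset) auto
  have lim2: "((\<lambda>t. f h - f 0 - (1 - t) * K) \<longlongrightarrow> f h - f 0 - (1 - 0) * K) (at_right 0)"
    by (intro tendsto_intros)
  have "\<forall>\<^sub>F t in at_right (0::real). (f (t * h) - f 0) / t \<le> f h - f 0 - (1 - t) * K"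
    unfolding eventually_at_right_field
  proof (intro exI[of _ 1] conjI allI impI)
    fix t :: real assume "0 < t" "t < 1"
    then show "(f (t * h) - f 0) / t \<le> f h - f 0 - (1 - t) * K"
      using conv[of t] by (subst pos_divide_le_eq) (auto simp: algebra_simps)
  qed simp
  from tendsto_le[OF _ lim2 lim this] show ?thesis by (simp add: algebra_simps)
qed

section \<open>Differentiation along finitely valued random variables\<close>

locale lipschitz_wasserstein_gradient =
  fixes F :: "'a::euclidean_space measure \<Rightarrow> real" and G :: "'a measure \<Rightarrow> 'a \<Rightarrow> 'a" and L :: real
  assumes L_pos: "L > 0"
    and differential: "\<rho> \<in> P2 \<Longrightarrow> G \<rho> \<in> wasserstein_differentials F \<rho>"
    and lipschitz: "\<rho> \<in> P2 \<Longrightarrow> \<rho>' \<in> P2 \<Longrightarrow>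
      norm (G \<rho> x - G \<rho>' y) \<le> L / 2 * (norm (x - y) + W2 \<rho> \<rho>')"
begin

lemma G_measurable: "\<rho> \<in> P2 \<Longrightarrow> G \<rho> \<in> borel_measurable borel"
  using differential by (auto simp: wasserstein_differentials_def L2_fields_def)

lemma G_square_integrable:
  assumes "\<rho> \<in> P2" shows "square_integrable \<rho> (G \<rho>)"
proof -
  have "sets \<rho> = sets borel" using assms by (simp add: P2_def)
  then have "G \<rho> \<in> borel_measurable \<rho>"
    using G_measurable[OF assms] by (simp add: measurable_cong_sets[of \<rho> borel])
  then show ?thesis
    using differential[OF assms]
    by (auto simp: wasserstein_differentials_def L2_fields_def square_integrable_def)
qed

lemma G_law_square_integrable:
  assumes "prob_space M" and X: "square_integrable M X"
  shows "square_integrable M (\<lambda>\<omega>. G (law M X) (X \<omega>))"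
  using G_square_integrable[OF law_in_P2[OF assms]] square_integrable_law_iff
    G_measurable[OF law_in_P2[OF assms]] square_integrableD(1)[OF X] by blast

text \<open>The selection of couplings is weakened to the existence of one optimal coupling for each
  target. Where the optimal coupling is unique, this determines it.\<close>

lemma expansion:
  assumes "\<rho> \<in> P2" "\<epsilon> > 0"
  obtains \<delta> where "\<delta> > 0"
    and "\<And>\<eta>. \<eta> \<in> P2 \<Longrightarrow> W2 \<rho> \<eta> < \<delta> \<Longrightarrow> \<exists>\<gamma>\<in>optimal_couplings \<rho> \<eta>.
      \<bar>F \<eta> - F \<rho> - (\<integral>z. G \<rho> (fst z) \<bullet> (snd z - fst z) \<partial>\<gamma>)\<bar> \<le> \<epsilon> * W2 \<rho> \<eta>"
proof -
  obtain \<Gamma> where \<Gamma>: "\<forall>\<eta>\<in>P2. \<Gamma> \<eta> \<in> optimal_couplings \<rho> \<eta>"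
    and "\<forall>\<epsilon>>0. \<exists>\<delta>>0. \<forall>\<eta>\<in>P2. W2 \<rho> \<eta> < \<delta> \<longrightarrow>
          \<bar>F \<eta> - F \<rho> - (\<integral>z. G \<rho> (fst z) \<bullet> (snd z - fst z) \<partial>\<Gamma> \<eta>)\<bar> \<le> \<epsilon> * W2 \<rho> \<eta>"
    using differential[OF assms(1)] by (auto simp: wasserstein_differentials_def)
  then obtain \<delta> where \<delta>: "\<delta> > 0" "\<forall>\<eta>\<in>P2. W2 \<rho> \<eta> < \<delta> \<longrightarrow>
          \<bar>F \<eta> - F \<rho> - (\<integral>z. G \<rho> (fst z) \<bullet> (snd z - fst z) \<partial>\<Gamma> \<eta>)\<bar> \<le> \<epsilon> * W2 \<rho> \<eta>"
    using assms(2) by meson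
  show ?thesis
    by (rule that[OF \<delta>(1)]) (use \<delta>(2) \<Gamma> in blast)
qed

text \<open>The expansion with \<open>\<epsilon> = 1\<close> suffices: its remainder is at most the
  distance itself, and Young's inequality bounds the linear term by a small multiple of the squared
  norm of the gradient plus a large multiple of the squared distance.\<close>

lemma F_continuous:
  assumes \<rho>: "\<rho> \<in> P2" and \<eta>: "\<And>n. \<eta> n \<in> P2" and lim: "(\<lambda>n. W2 \<rho> (\<eta> n)) \<longlonglongrightarrow> 0"
  shows "(\<lambda>n. F (\<eta> n)) \<longlonglongrightarrow> F \<rho>"
proof (rule tendstoI)
  fix e :: real assume "e > 0"
  define A where "A = (\<integral>x. (norm (G \<rho> x))\<^sup>2 \<partial>\<rho>)"
  have "A \<ge> 0" by (simp add: A_def)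
  \<comment> \<open>Young's parameter is chosen so that the gradient part costs at most
    \<open>e / 2\<close>; the summand 1 covers a vanishing gradient.\<close>
  define a where "a = e / (A + 1)"
  have "a > 0" using \<open>e > 0\<close> \<open>A \<ge> 0\<close> by (simp add: a_def)
  have aA: "a * A \<le> e"
    using \<open>e > 0\<close> \<open>A \<ge> 0\<close> by (simp add: a_def field_simps)
  obtain \<delta> where \<delta>: "\<delta> > 0" "\<And>\<eta>. \<eta> \<in> P2 \<Longrightarrow> W2 \<rho> \<eta> < \<delta> \<Longrightarrow> \<exists>\<gamma>\<in>optimal_couplings \<rho> \<eta>.
      \<bar>F \<eta> - F \<rho> - (\<integral>z. G \<rho> (fst z) \<bullet> (snd z - fst z) \<partial>\<gamma>)\<bar> \<le> 1 * W2 \<rho> \<eta>"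
    using expansion[OF \<rho> zero_less_one] by blast
  have bound: "\<bar>F \<nu> - F \<rho>\<bar> \<le> e / 2 + ((W2 \<rho> \<nu>)\<^sup>2 / (2 * a) + W2 \<rho> \<nu>)"
    if \<nu>: "\<nu> \<in> P2" "W2 \<rho> \<nu> < \<delta>" for \<nu>
  proof -
    obtain \<gamma> where \<gamma>: "\<gamma> \<in> optimal_couplings \<rho> \<nu>"
      and le: "\<bar>F \<nu> - F \<rho> - (\<integral>z. G \<rho> (fst z) \<bullet> (snd z - fst z) \<partial>\<gamma>)\<bar> \<le> W2 \<rho> \<nu>"
      using \<delta>(2)[OF \<nu>] by auto
    have g: "prob_space \<gamma>" "sets \<gamma> = sets borel" "law \<gamma> fst = \<rho>" "law \<gamma> snd = \<nu>"
      "transport_cost \<gamma> = (W2 \<rho> \<nu>)\<^sup>2"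
      using \<gamma> by (auto simp: optimal_couplings_def couplings_def)
    note [measurable_cong] = g(2) and [measurable] = G_measurable[OF \<rho>]
    have fs: "fst \<in> borel_measurable \<gamma>" "snd \<in> borel_measurable \<gamma>" by measurable
    have "square_integrable (law \<gamma> fst) (\<lambda>x. x)" "square_integrable (law \<gamma> snd) (\<lambda>x. x)"
      "square_integrable (law \<gamma> fst) (G \<rho>)"
      unfolding g(3,4)
      by (rule P2_square_integrable_id[OF \<rho>] P2_square_integrable_id[OF \<nu>(1)] G_square_integrable[OF \<rho>])+
    then have "square_integrable \<gamma> fst" and "square_integrable \<gamma> snd"
      and \<xi>: "square_integrable \<gamma> (\<lambda>z. G \<rho> (fst z))"
      by (simp_all only: square_integrable_law_iff[OF fs(1)] square_integrable_law_iff[OF fs(2)]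
          measurable_ident_sets[OF refl] G_measurable[OF \<rho>])
    then have w: "square_integrable \<gamma> (\<lambda>z. snd z - fst z)" by (intro square_integrable_intros)
    have A': "(\<integral>z. (norm (G \<rho> (fst z)))\<^sup>2 \<partial>\<gamma>) = A"
      unfolding A_def g(3)[symmetric] by (subst integral_distr) (auto simp: g)
    have W': "(\<integral>z. (norm (snd z - fst z))\<^sup>2 \<partial>\<gamma>) = (W2 \<rho> \<nu>)\<^sup>2"
      unfolding g(5)[symmetric] by (simp add: transport_cost_def norm_minus_commute)
    have young: "\<bar>u \<bullet> v\<bar> \<le> a / 2 * (norm u)\<^sup>2 + 1 / (2 * a) * (norm v)\<^sup>2" for u v :: 'a
    proof -
      have "0 \<le> (a * norm u - norm v)\<^sup>2" by simp
      then have "norm u * norm v \<le> a / 2 * (norm u)\<^sup>2 + 1 / (2 * a) * (norm v)\<^sup>2"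
        using \<open>a > 0\<close> by (simp add: field_simps power2_eq_square)
      with Cauchy_Schwarz_ineq2[of u v] show ?thesis by linarith
    qed
    have "\<bar>\<integral>z. G \<rho> (fst z) \<bullet> (snd z - fst z) \<partial>\<gamma>\<bar> \<le> (\<integral>z. \<bar>G \<rho> (fst z) \<bullet> (snd z - fst z)\<bar> \<partial>\<gamma>)"
      by (rule integral_abs_bound)
    also have "\<dots> \<le> (\<integral>z. a / 2 * (norm (G \<rho> (fst z)))\<^sup>2 + 1 / (2 * a) * (norm (snd z - fst z))\<^sup>2 \<partial>\<gamma>)"
      using young square_integrable_inner[OF \<xi> w] square_integrableD(2)[OF \<xi>] square_integrableD(2)[OF w]
      by (intro integral_mono) auto
    also have "\<dots> = a / 2 * A + (W2 \<rho> \<nu>)\<^sup>2 / (2 * a)"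
      using square_integrableD(2)[OF \<xi>] square_integrableD(2)[OF w] by (simp add: A' W')
    also have "a / 2 * A \<le> e / 2" using aA by simp
    finally show ?thesis using le by linarith
  qed
  have "(\<lambda>n. (W2 \<rho> (\<eta> n))\<^sup>2 / (2 * a) + W2 \<rho> (\<eta> n)) \<longlonglongrightarrow> 0\<^sup>2 / (2 * a) + 0"
    using \<open>a > 0\<close> by (intro tendsto_intros lim) auto
  then have "\<forall>\<^sub>F n in sequentially. (W2 \<rho> (\<eta> n))\<^sup>2 / (2 * a) + W2 \<rho> (\<eta> n) < e / 2"
    using \<open>e > 0\<close> by (intro order_tendstoD(2)) auto
  moreover have "\<forall>\<^sub>F n in sequentially. W2 \<rho> (\<eta> n) < \<delta>"
    using lim \<delta>(1) by (rule order_tendstoD(2))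
  ultimately show "\<forall>\<^sub>F n in sequentially. dist (F (\<eta> n)) (F \<rho>) < e"
    by eventually_elim (use bound[OF \<eta>] in \<open>fastforce simp: dist_real_def\<close>)
qed

text \<open>Recentre at \<open>Z = X + t V\<close>, which is again finitely valued. For small
  \<open>h\<close> the unknown optimal coupling in the expansion must be the joint law of
  \<open>Z\<close> and \<open>Z + h V\<close>, so the linear term is exactly \<open>D * h\<close>,
  and the distance is at most \<open>\<bar>h\<bar> * c\<close>, which turns the remainder into one
  of order o(h).\<close>

lemma simple_has_derivative:
  fixes X V :: "'b \<Rightarrow> 'a"
  assumes M: "prob_space M" and X: "simple_function M X" and V: "simple_function M V"
  shows "((\<lambda>t. F (law M (\<lambda>\<omega>. X \<omega> + t *\<^sub>R V \<omega>))) has_real_derivative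
    (\<integral>\<omega>. G (law M (\<lambda>\<omega>. X \<omega> + t *\<^sub>R V \<omega>)) (X \<omega> + t *\<^sub>R V \<omega>) \<bullet> V \<omega> \<partial>M)) (at t)"
proof -
  interpret prob_space M by fact
  define Z where "Z \<omega> = X \<omega> + t *\<^sub>R V \<omega>" for \<omega>
  have Z: "simple_function M Z"
    unfolding Z_def using X V by (intro simple_function_add simple_function_compose1[where g="\<lambda>v. t *\<^sub>R v"])
  have sV: "square_integrable M V" and sZ: "square_integrable M Z"
    using V Z by (auto intro: simple_function_square_integrable finite_measure_axioms)
  have sZh: "square_integrable M (\<lambda>\<omega>. Z \<omega> + h *\<^sub>R V \<omega>)" for h
    using sV sZ by (intro square_integrable_intros)
  have [measurable]: "V \<in> borel_measurable M" "Z \<in> borel_measurable M"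
    using sV sZ by (auto dest: square_integrableD)
  note P2 = law_in_P2[OF M sZ] law_in_P2[OF M sZh]
  note [measurable] = G_measurable[OF P2(1)]
  define D where "D = (\<integral>\<omega>. G (law M Z) (Z \<omega>) \<bullet> V \<omega> \<partial>M)"
  define c where "c = sqrt (\<integral>\<omega>. (norm (V \<omega>))\<^sup>2 \<partial>M)"
  have "c \<ge> 0" by (simp add: c_def)
  have W2_le: "W2 (law M Z) (law M (\<lambda>\<omega>. Z \<omega> + h *\<^sub>R V \<omega>)) \<le> \<bar>h\<bar> * c" for h
    using W2_law_le[OF M, of Z "\<lambda>\<omega>. Z \<omega> + h *\<^sub>R V \<omega>"]
    by (simp add: c_def real_sqrt_mult power_mult_distrib)
  obtain d where d: "d > 0" "\<And>h. \<bar>h\<bar> < d \<Longrightarrow> optimal_couplings (law M Z) (law M (\<lambda>\<omega>. Z \<omega> + h *\<^sub>R V \<omega>))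
      = {law M (\<lambda>\<omega>. (Z \<omega>, Z \<omega> + h *\<^sub>R V \<omega>))}"
    using optimal_couplings_small_step[OF M Z V] by blast
  have "((\<lambda>t. F (law M (\<lambda>\<omega>. X \<omega> + t *\<^sub>R V \<omega>))) has_real_derivative D) (at t)"
    unfolding has_field_derivative_def has_derivative_at_alt
  proof (intro conjI allI impI)
    show "bounded_linear ((*) D)" by (rule bounded_linear_mult_right)
    fix e :: real assume "e > 0"
    \<comment> \<open>Using \<open>c + 1\<close> in place of \<open>c\<close> covers a
      \<open>V\<close> that vanishes almost everywhere.\<close>
    have "e / (c + 1) > 0" using \<open>e > 0\<close> \<open>c \<ge> 0\<close> by simp
    then obtain \<delta> where \<delta>: "\<delta> > 0" "\<And>\<eta>. \<eta> \<in> P2 \<Longrightarrow> W2 (law M Z) \<eta> < \<delta> \<Longrightarrow>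
      \<exists>\<gamma>\<in>optimal_couplings (law M Z) \<eta>.
      \<bar>F \<eta> - F (law M Z) - (\<integral>z. G (law M Z) (fst z) \<bullet> (snd z - fst z) \<partial>\<gamma>)\<bar> \<le> e / (c + 1) * W2 (law M Z) \<eta>"
      using expansion[OF P2(1)] by blast
    show "\<exists>d>0. \<forall>y. norm (y - t) < d \<longrightarrow>
      norm (F (law M (\<lambda>\<omega>. X \<omega> + y *\<^sub>R V \<omega>)) - F (law M (\<lambda>\<omega>. X \<omega> + t *\<^sub>R V \<omega>)) - D * (y - t))
        \<le> e * norm (y - t)"
    proof (intro exI[of _ "min d (\<delta> / (c + 1))"] conjI allI impI)
      show "0 < min d (\<delta> / (c + 1))" using d \<delta> \<open>c \<ge> 0\<close> by simp
      fix y assume y: "norm (y - t) < min d (\<delta> / (c + 1))"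
      define h where "h = y - t"
      have h: "\<bar>h\<bar> < d" "\<bar>h\<bar> * (c + 1) < \<delta>"
        using y \<open>c \<ge> 0\<close> by (auto simp: h_def field_simps)
      let ?\<eta> = "law M (\<lambda>\<omega>. Z \<omega> + h *\<^sub>R V \<omega>)"
      have eq: "(\<lambda>\<omega>. X \<omega> + y *\<^sub>R V \<omega>) = (\<lambda>\<omega>. Z \<omega> + h *\<^sub>R V \<omega>)"
        by (auto simp: Z_def h_def algebra_simps)
      have "W2 (law M Z) ?\<eta> < \<delta>" using W2_le[of h] h by (simp add: algebra_simps)
      then have "\<bar>F ?\<eta> - F (law M Z) - (\<integral>z. G (law M Z) (fst z) \<bullet> (snd z - fst z)
          \<partial>law M (\<lambda>\<omega>. (Z \<omega>, Z \<omega> + h *\<^sub>R V \<omega>)))\<bar> \<le> e / (c + 1) * W2 (law M Z) ?\<eta>"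
        using \<delta>(2)[OF P2(2), of h] d(2)[OF h(1)] by simp
      also have "(\<integral>z. G (law M Z) (fst z) \<bullet> (snd z - fst z) \<partial>law M (\<lambda>\<omega>. (Z \<omega>, Z \<omega> + h *\<^sub>R V \<omega>)))
        = D * h"
        by (subst integral_distr) (auto simp: D_def mult.commute)
      also have "e / (c + 1) * W2 (law M Z) ?\<eta> \<le> e / (c + 1) * (\<bar>h\<bar> * (c + 1))"
        using W2_le[of h] \<open>e > 0\<close> \<open>c \<ge> 0\<close> by (intro mult_left_mono) (auto simp: algebra_simps)
      also have "\<dots> = e * \<bar>h\<bar>" using \<open>c \<ge> 0\<close> by simp
      finally show "norm (F (law M (\<lambda>\<omega>. X \<omega> + y *\<^sub>R V \<omega>)) - F (law M (\<lambda>\<omega>. X \<omega> + t *\<^sub>R V \<omega>)) - D * (y - t))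
        \<le> e * norm (y - t)"
        unfolding eq by (simp add: h_def Z_def)
    qed
  qed
  then show ?thesis by (simp add: D_def Z_def[abs_def])
qed

text \<open>Along the line, the displacement is \<open>t * norm (V \<omega>)\<close> pointwise while
  the laws are at distance at most \<open>t * sqrt C\<close>; both enter the growth of the
  derivative linearly in \<open>t\<close>.\<close>

lemma simple_descent:
  fixes X V :: "'b \<Rightarrow> 'a"
  assumes M: "prob_space M" and X: "simple_function M X" and V: "simple_function M V"
  shows "F (law M (\<lambda>\<omega>. X \<omega> + V \<omega>)) \<le>
    F (law M X) + (\<integral>\<omega>. G (law M X) (X \<omega>) \<bullet> V \<omega> \<partial>M) + L / 2 * (\<integral>\<omega>. (norm (V \<omega>))\<^sup>2 \<partial>M)"
proof -
  interpret prob_space M by fact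
  have sX: "square_integrable M X" and sV: "square_integrable M V"
    using X V by (auto intro: simple_function_square_integrable finite_measure_axioms)
  have [measurable]: "V \<in> borel_measurable M" "X \<in> borel_measurable M"
    using sV sX by (auto dest: square_integrableD)
  have sXt: "square_integrable M (\<lambda>\<omega>. X \<omega> + t *\<^sub>R V \<omega>)" for t
    using sV sX by (intro square_integrable_intros)
  define f where "f t = F (law M (\<lambda>\<omega>. X \<omega> + t *\<^sub>R V \<omega>))" for t
  define f' where "f' t = (\<integral>\<omega>. G (law M (\<lambda>\<omega>. X \<omega> + t *\<^sub>R V \<omega>)) (X \<omega> + t *\<^sub>R V \<omega>) \<bullet> V \<omega> \<partial>M)" for t
  define C where "C = (\<integral>\<omega>. (norm (V \<omega>))\<^sup>2 \<partial>M)"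
  have "C \<ge> 0" by (simp add: C_def)
  have "f 1 \<le> f 0 + f' 0 + L / 2 * C"
  proof (rule descent_of_derivative_bound[where f' = f'])
    show "(f has_real_derivative f' t) (at t)" for t
      unfolding f_def f'_def by (rule simple_has_derivative[OF M X V])
    fix t :: real assume "0 \<le> t"
    let ?Xt = "\<lambda>\<omega>. X \<omega> + t *\<^sub>R V \<omega>"
    have W: "W2 (law M ?Xt) (law M X) \<le> t * sqrt C"
      using W2_law_le[OF M, of ?Xt X] \<open>0 \<le> t\<close>
      by (simp add: C_def real_sqrt_mult power_mult_distrib)
    \<comment> \<open>The mixed product \<open>sqrt C * norm (V \<omega>)\<close> is split evenly by
      the arithmetic-geometric mean inequality. After integration 3/2 and 1/2 add up to 2, which
      gives the slope bound \<open>L * C * t\<close>.\<close>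
    have pt: "G (law M ?Xt) (?Xt \<omega>) \<bullet> V \<omega> - G (law M X) (X \<omega>) \<bullet> V \<omega>
        \<le> L / 2 * t * (3 / 2 * (norm (V \<omega>))\<^sup>2 + C / 2)" for \<omega>
    proof -
      have "G (law M ?Xt) (?Xt \<omega>) \<bullet> V \<omega> - G (law M X) (X \<omega>) \<bullet> V \<omega>
        = (G (law M ?Xt) (?Xt \<omega>) - G (law M X) (X \<omega>)) \<bullet> V \<omega>" by (simp add: inner_diff_left)
      also have "\<dots> \<le> norm (G (law M ?Xt) (?Xt \<omega>) - G (law M X) (X \<omega>)) * norm (V \<omega>)"
        by (rule norm_cauchy_schwarz)
      also have "\<dots> \<le> L / 2 * (norm (?Xt \<omega> - X \<omega>) + W2 (law M ?Xt) (law M X)) * norm (V \<omega>)"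
        by (intro mult_right_mono lipschitz law_in_P2[OF M] sX sXt) auto
      also have "\<dots> \<le> L / 2 * (t * norm (V \<omega>) + t * sqrt C) * norm (V \<omega>)"
        using W \<open>0 \<le> t\<close> L_pos by (intro mult_right_mono mult_left_mono) auto
      also have "\<dots> = L / 2 * t * ((norm (V \<omega>))\<^sup>2 + sqrt C * norm (V \<omega>))"
        by (simp add: algebra_simps power2_eq_square)
      also have "\<dots> \<le> L / 2 * t * (3 / 2 * (norm (V \<omega>))\<^sup>2 + C / 2)"
        using sum_squares_bound[of "sqrt C" "norm (V \<omega>)"] \<open>0 \<le> t\<close> L_pos \<open>C \<ge> 0\<close>
        by (intro mult_left_mono) auto
      finally show ?thesis .
    qed
    have i: "integrable M (\<lambda>\<omega>. G (law M ?Xt) (?Xt \<omega>) \<bullet> V \<omega>)" "integrable M (\<lambda>\<omega>. G (law M X) (X \<omega>) \<bullet> V \<omega>)"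
      by (intro square_integrable_inner G_law_square_integrable M sX sXt sV)+
    have "f' t - f' 0 = (\<integral>\<omega>. G (law M ?Xt) (?Xt \<omega>) \<bullet> V \<omega> - G (law M X) (X \<omega>) \<bullet> V \<omega> \<partial>M)"
      using i by (simp add: f'_def)
    also have "\<dots> \<le> (\<integral>\<omega>. L / 2 * t * (3 / 2 * (norm (V \<omega>))\<^sup>2 + C / 2) \<partial>M)"
      using i square_integrableD(2)[OF sV] pt by (intro integral_mono) auto
    also have "\<dots> = L / 2 * t * (3 / 2 * C + C / 2)"
      using square_integrableD(2)[OF sV] by (simp add: C_def prob_space)
    finally show "f' t \<le> f' 0 + 2 * (L / 2 * C) * t" by (simp add: algebra_simps)
  qed
  then show ?thesis by (simp add: f_def f'_def C_def)
qed

text \<open>Only short pieces of the line are known to be geodesics. The modulus survives this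
  localisation because the convexity gain on a piece of length parameter \<open>h\<close> is
  quadratic in \<open>h\<close> with the same constant \<open>m / 2 * C\<close> at every
  \<open>t\<close>.\<close>

lemma simple_support:
  fixes X V :: "'b \<Rightarrow> 'a"
  assumes M: "prob_space M" and X: "simple_function M X" and V: "simple_function M V"
    and conv: "geodesically_convex m F"
  shows "F (law M X) + (\<integral>\<omega>. G (law M X) (X \<omega>) \<bullet> V \<omega> \<partial>M) + m / 2 * (\<integral>\<omega>. (norm (V \<omega>))\<^sup>2 \<partial>M)
    \<le> F (law M (\<lambda>\<omega>. X \<omega> + V \<omega>))"
proof -
  interpret prob_space M by fact
  have sX: "square_integrable M X" and sV: "square_integrable M V"
    using X V by (auto intro: simple_function_square_integrable finite_measure_axioms)
  have [measurable]: "V \<in> borel_measurable M" "X \<in> borel_measurable M"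
    using sV sX by (auto dest: square_integrableD)
  have sXt: "square_integrable M (\<lambda>\<omega>. X \<omega> + t *\<^sub>R V \<omega>)" for t
    using sV sX by (intro square_integrable_intros)
  define f where "f t = F (law M (\<lambda>\<omega>. X \<omega> + t *\<^sub>R V \<omega>))" for t
  define f' where "f' t = (\<integral>\<omega>. G (law M (\<lambda>\<omega>. X \<omega> + t *\<^sub>R V \<omega>)) (X \<omega> + t *\<^sub>R V \<omega>) \<bullet> V \<omega> \<partial>M)" for t
  define C where "C = (\<integral>\<omega>. (norm (V \<omega>))\<^sup>2 \<partial>M)"
  have deriv: "(f has_real_derivative f' t) (at t)" for t
    unfolding f_def f'_def by (rule simple_has_derivative[OF M X V])
  have "f 0 + f' 0 + m / 2 * C \<le> f 1"
  proof (rule strongly_convex_of_local_support[OF deriv])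
    fix t
    define Z where "Z \<omega> = X \<omega> + t *\<^sub>R V \<omega>" for \<omega>
    have Z: "simple_function M Z"
      unfolding Z_def using X V by (intro simple_function_add simple_function_compose1[where g="\<lambda>v. t *\<^sub>R v"])
    have Zt: "(\<lambda>\<omega>. X \<omega> + (t + h) *\<^sub>R V \<omega>) = (\<lambda>\<omega>. Z \<omega> + h *\<^sub>R V \<omega>)" for h
      by (auto simp: Z_def algebra_simps)
    have Zt0: "(\<lambda>\<omega>. X \<omega> + t *\<^sub>R V \<omega>) = Z"
      by (auto simp: Z_def algebra_simps)
    have [measurable]: "Z \<in> borel_measurable M" unfolding Z_def by measurable
    obtain d where d: "d > 0" "\<And>h. \<bar>h\<bar> < d \<Longrightarrow> optimal_couplings (law M Z) (law M (\<lambda>\<omega>. Z \<omega> + h *\<^sub>R V \<omega>))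
      = {law M (\<lambda>\<omega>. (Z \<omega>, Z \<omega> + h *\<^sub>R V \<omega>))}"
      using optimal_couplings_small_step[OF M Z V] by blast
    show "\<exists>d>0. \<forall>h. \<bar>h\<bar> < d \<longrightarrow> f t + h * f' t + m / 2 * C * h\<^sup>2 \<le> f (t + h)"
    proof (intro exI[of _ d] conjI allI impI)
      fix h assume "\<bar>h\<bar> < d"
      let ?\<gamma> = "law M (\<lambda>\<omega>. (Z \<omega>, Z \<omega> + h *\<^sub>R V \<omega>))"
      have \<gamma>: "?\<gamma> \<in> optimal_couplings (law M Z) (law M (\<lambda>\<omega>. Z \<omega> + h *\<^sub>R V \<omega>))"
        using d(2)[OF \<open>\<bar>h\<bar> < d\<close>] by simp
      \<comment> \<open>Equality matters here: for positive \<open>m\<close> the gain in geodesic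
        convexity needs a lower bound on the distance, and the synchronous coupling alone would only
        give an upper one.\<close>
      then have W: "(W2 (law M Z) (law M (\<lambda>\<omega>. Z \<omega> + h *\<^sub>R V \<omega>)))\<^sup>2 = h\<^sup>2 * C"
        using transport_cost_law[of Z M "\<lambda>\<omega>. Z \<omega> + h *\<^sub>R V \<omega>"]
        by (simp add: optimal_couplings_def C_def power_mult_distrib)
      have "f (t + 0) + h * f' t + m / 2 * C * h\<^sup>2 \<le> f (t + h)"
      proof (rule support_of_strong_convexity[where f="\<lambda>\<tau>. f (t + \<tau>)"])
        show "((\<lambda>\<tau>. f (t + \<tau>)) has_real_derivative f' t) (at 0)"
          using deriv[of t] DERIV_at_within_shift[of f "f' t" t 0 UNIV] by (simp add: ac_simps)
        fix \<tau> :: real assume \<tau>: "0 \<le> \<tau>" "\<tau> \<le> 1"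
        have "distr ?\<gamma> borel (\<lambda>(x, y). (1 - \<tau>) *\<^sub>R x + \<tau> *\<^sub>R y) = law M (\<lambda>\<omega>. Z \<omega> + (\<tau> * h) *\<^sub>R V \<omega>)"
          by (subst distr_distr) (auto simp: comp_def case_prod_beta algebra_simps intro!: borel_measurable_continuous_onI continuous_intros)
        then show "f (t + \<tau> * h) \<le> (1 - \<tau>) * f (t + 0) + \<tau> * f (t + h) - \<tau> * (1 - \<tau>) * (m / 2 * C * h\<^sup>2)"
          using conv[unfolded geodesically_convex_def, rule_format, OF _ _ \<gamma>, of \<tau>] \<tau> W
            law_in_P2[OF M sXt, of t] law_in_P2[OF M sXt, of "t + h"]
          by (simp add: f_def Zt Zt0 mult_ac)
      qed
      then show "f t + h * f' t + m / 2 * C * h\<^sup>2 \<le> f (t + h)" by simp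
    qed (fact d(1))
  qed
  then show ?thesis by (simp add: f_def f'_def C_def)
qed

end

section \<open>Passage to square integrable random variables\<close>

text \<open>Coupling both variables on the same space bounds the distance by the mean square
  difference, which tends to 0 by dominated convergence.\<close>

lemma W2_law_tendsto_0:
  fixes X :: "'b \<Rightarrow> 'a::euclidean_space"
  assumes M: "prob_space M" and [measurable]: "X \<in> borel_measurable M" "\<And>n. Y n \<in> borel_measurable M"
    and lim: "\<And>\<omega>. \<omega> \<in> space M \<Longrightarrow> (\<lambda>n. Y n \<omega>) \<longlonglongrightarrow> X \<omega>"
    and dom: "\<And>n \<omega>. \<omega> \<in> space M \<Longrightarrow> norm (X \<omega> - Y n \<omega>) \<le> R \<omega>" and R: "integrable M (\<lambda>\<omega>. (R \<omega>)\<^sup>2)"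
  shows "(\<lambda>n. W2 (law M X) (law M (Y n))) \<longlonglongrightarrow> 0"
proof -
  have "(\<lambda>n. \<integral>\<omega>. (norm (X \<omega> - Y n \<omega>))\<^sup>2 \<partial>M) \<longlonglongrightarrow> (\<integral>\<omega>. 0 \<partial>M)"
  proof (rule integral_dominated_convergence[OF _ _ R])
    show "AE \<omega> in M. (\<lambda>n. (norm (X \<omega> - Y n \<omega>))\<^sup>2) \<longlonglongrightarrow> 0"
    proof (rule AE_I2)
      fix \<omega> assume "\<omega> \<in> space M"
      then have "(\<lambda>n. (norm (X \<omega> - Y n \<omega>))\<^sup>2) \<longlonglongrightarrow> (norm (X \<omega> - X \<omega>))\<^sup>2"
        by (intro tendsto_intros lim)
      then show "(\<lambda>n. (norm (X \<omega> - Y n \<omega>))\<^sup>2) \<longlonglongrightarrow> 0" by simp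
    qed
    show "AE \<omega> in M. norm ((norm (X \<omega> - Y n \<omega>))\<^sup>2) \<le> (R \<omega>)\<^sup>2" for n
      using dom by (intro AE_I2) (auto intro!: power_mono)
  qed measurable
  then have "(\<lambda>n. sqrt (\<integral>\<omega>. (norm (X \<omega> - Y n \<omega>))\<^sup>2 \<partial>M)) \<longlonglongrightarrow> sqrt 0"
    by (intro tendsto_real_sqrt) simp
  then have lim0: "(\<lambda>n. sqrt (\<integral>\<omega>. (norm (X \<omega> - Y n \<omega>))\<^sup>2 \<partial>M)) \<longlonglongrightarrow> 0" by simp
  have nonneg: "0 \<le> W2 (law M X) (law M (Y n))" for n
    using coupling_law[OF M, of X "Y n"] by (intro W2_nonneg_of_coupling) auto
  have "W2 (law M X) (law M (Y n)) \<le> sqrt (\<integral>\<omega>. (norm (X \<omega> - Y n \<omega>))\<^sup>2 \<partial>M)" for n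
    by (rule W2_law_le[OF M]) measurable
  with nonneg show ?thesis
    by (intro tendsto_sandwich[OF _ _ tendsto_const lim0] always_eventually) auto
qed

lemma simple_function_approximation:
  fixes X :: "'b \<Rightarrow> 'a::euclidean_space"
  assumes "X \<in> borel_measurable M"
  obtains S where "\<And>n. simple_function M (S n)" "\<And>\<omega>. \<omega> \<in> space M \<Longrightarrow> (\<lambda>n. S n \<omega>) \<longlonglongrightarrow> X \<omega>"
    "\<And>n \<omega>. \<omega> \<in> space M \<Longrightarrow> norm (S n \<omega>) \<le> 2 * norm (X \<omega>)"
proof -
  obtain S where "(\<forall>i. simple_function M (S i))" "(\<forall>x\<in>space M. (\<lambda>i. S i x) \<longlonglongrightarrow> X x)"
    "(\<forall>i. \<forall>x\<in>space M. dist (S i x) 0 \<le> 2 * dist (X x) 0)"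
    using borel_measurable_implies_sequence_metric[OF assms, of 0] by blast
  then show ?thesis by (intro that[of S]) auto
qed

context lipschitz_wasserstein_gradient
begin

text \<open>The delicate limit is the gradient pairing, where both the law and the point at which
  \<open>G\<close> is evaluated move. The Lipschitz bound in both arguments gives pointwise
  convergence and also an integrable majorant.\<close>

lemma simple_approximation:
  fixes X V :: "'b \<Rightarrow> 'a"
  assumes M: "prob_space M" and X: "square_integrable M X" and V: "square_integrable M V"
  obtains S T where "\<And>n. simple_function M (S n)" "\<And>n. simple_function M (T n)"
    "(\<lambda>n. F (law M (S n))) \<longlonglongrightarrow> F (law M X)"
    "(\<lambda>n. F (law M (\<lambda>\<omega>. S n \<omega> + T n \<omega>))) \<longlonglongrightarrow> F (law M (\<lambda>\<omega>. X \<omega> + V \<omega>))"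
    "(\<lambda>n. \<integral>\<omega>. G (law M (S n)) (S n \<omega>) \<bullet> T n \<omega> \<partial>M) \<longlonglongrightarrow> (\<integral>\<omega>. G (law M X) (X \<omega>) \<bullet> V \<omega> \<partial>M)"
    "(\<lambda>n. \<integral>\<omega>. (norm (T n \<omega>))\<^sup>2 \<partial>M) \<longlonglongrightarrow> (\<integral>\<omega>. (norm (V \<omega>))\<^sup>2 \<partial>M)"
proof -
  interpret prob_space M by fact
  note [measurable] = square_integrableD(1)[OF X] square_integrableD(1)[OF V]
  obtain S where S: "\<And>n. simple_function M (S n)" "\<And>\<omega>. \<omega> \<in> space M \<Longrightarrow> (\<lambda>n. S n \<omega>) \<longlonglongrightarrow> X \<omega>"
    "\<And>n \<omega>. \<omega> \<in> space M \<Longrightarrow> norm (S n \<omega>) \<le> 2 * norm (X \<omega>)"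
    using simple_function_approximation[of X M] by auto
  obtain T where T: "\<And>n. simple_function M (T n)" "\<And>\<omega>. \<omega> \<in> space M \<Longrightarrow> (\<lambda>n. T n \<omega>) \<longlonglongrightarrow> V \<omega>"
    "\<And>n \<omega>. \<omega> \<in> space M \<Longrightarrow> norm (T n \<omega>) \<le> 2 * norm (V \<omega>)"
    using simple_function_approximation[of V M] by auto
  have sS: "square_integrable M (S n)" and sT: "square_integrable M (T n)" for n
    using S(1) T(1) by (auto intro: simple_function_square_integrable finite_measure_axioms)
  have [measurable]: "S n \<in> borel_measurable M" "T n \<in> borel_measurable M" for n
    using sS sT by (auto dest: square_integrableD)
  have sXV: "square_integrable M (\<lambda>\<omega>. X \<omega> + V \<omega>)" and sST: "square_integrable M (\<lambda>\<omega>. S n \<omega> + T n \<omega>)" for n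
    using X V sS sT by (auto intro: square_integrable_add)
  have dX: "norm (X \<omega> - S n \<omega>) \<le> 3 * norm (X \<omega>)" if "\<omega> \<in> space M" for n \<omega>
    using S(3)[OF that, of n] norm_triangle_ineq4[of "X \<omega>" "S n \<omega>"] by simp
  have dV: "norm (V \<omega> - T n \<omega>) \<le> 3 * norm (V \<omega>)" if "\<omega> \<in> space M" for n \<omega>
    using T(3)[OF that, of n] norm_triangle_ineq4[of "V \<omega>" "T n \<omega>"] by simp
  have iX: "integrable M (\<lambda>\<omega>. (3 * norm (X \<omega>))\<^sup>2)"
    using square_integrableD(2)[OF X] by (simp add: power_mult_distrib)
  have iXV: "integrable M (\<lambda>\<omega>. (3 * norm (X \<omega>) + 3 * norm (V \<omega>))\<^sup>2)"
  proof (rule Bochner_Integration.integrable_bound)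
    show "integrable M (\<lambda>\<omega>. 18 * (norm (X \<omega>))\<^sup>2 + 18 * (norm (V \<omega>))\<^sup>2)"
      using square_integrableD(2)[OF X] square_integrableD(2)[OF V] by simp
    have "(3 * norm (X \<omega>) + 3 * norm (V \<omega>))\<^sup>2 \<le> 18 * (norm (X \<omega>))\<^sup>2 + 18 * (norm (V \<omega>))\<^sup>2" for \<omega>
      using sum_squares_bound[of "norm (X \<omega>)" "norm (V \<omega>)"] by (simp add: power2_sum power_mult_distrib)
    then show "AE \<omega> in M. norm ((3 * norm (X \<omega>) + 3 * norm (V \<omega>))\<^sup>2) \<le> norm (18 * (norm (X \<omega>))\<^sup>2 + 18 * (norm (V \<omega>))\<^sup>2)"
      by (intro AE_I2) auto
  qed measurable
  have WS: "(\<lambda>n. W2 (law M X) (law M (S n))) \<longlonglongrightarrow> 0"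
    using dX S(2) by (intro W2_law_tendsto_0[OF M _ _ _ _ iX]) auto
  have WST: "(\<lambda>n. W2 (law M (\<lambda>\<omega>. X \<omega> + V \<omega>)) (law M (\<lambda>\<omega>. S n \<omega> + T n \<omega>))) \<longlonglongrightarrow> 0"
  proof (rule W2_law_tendsto_0[OF M _ _ _ _ iXV])
    show "norm (X \<omega> + V \<omega> - (S n \<omega> + T n \<omega>)) \<le> 3 * norm (X \<omega>) + 3 * norm (V \<omega>)" if "\<omega> \<in> space M" for n \<omega>
      using dX[OF that, of n] dV[OF that, of n] norm_triangle_ineq[of "X \<omega> - S n \<omega>" "V \<omega> - T n \<omega>"]
      by (simp add: algebra_simps)
  qed (auto intro!: tendsto_add S(2) T(2))
  \<comment> \<open>A convergent sequence is bounded; \<open>K\<close> makes the contribution of the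
    moving law to the majorant uniform in \<open>n\<close>.\<close>
  obtain K where K: "\<And>n. \<bar>W2 (law M X) (law M (S n))\<bar> \<le> K"
    using convergent_imp_Bseq[OF convergentI[OF WS]] by (auto simp: Bseq_def)
  note P2X = law_in_P2[OF M X] and P2S = law_in_P2[OF M sS]
  note [measurable] = G_measurable[OF P2X] G_measurable[OF P2S]
  have lip: "norm (G (law M X) (X \<omega>) - G (law M (S n)) (S n \<omega>))
    \<le> L / 2 * (norm (X \<omega> - S n \<omega>) + W2 (law M X) (law M (S n)))" for n \<omega>
    by (rule lipschitz[OF P2X P2S])
  have GS: "(\<lambda>n. G (law M (S n)) (S n \<omega>)) \<longlonglongrightarrow> G (law M X) (X \<omega>)" if "\<omega> \<in> space M" for \<omega>
  proof (rule LIM_zero_cancel, rule Lim_null_comparison)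
    show "\<forall>\<^sub>F n in sequentially. norm (G (law M (S n)) (S n \<omega>) - G (law M X) (X \<omega>))
      \<le> L / 2 * (norm (X \<omega> - S n \<omega>) + W2 (law M X) (law M (S n)))"
      using lip[of \<omega>] by (intro always_eventually) (simp add: norm_minus_commute)
    have "(\<lambda>n. L / 2 * (norm (X \<omega> - S n \<omega>) + W2 (law M X) (law M (S n))))
      \<longlonglongrightarrow> L / 2 * (norm (X \<omega> - X \<omega>) + 0)"
      by (intro tendsto_intros WS S(2) that)
    then show "(\<lambda>n. L / 2 * (norm (X \<omega> - S n \<omega>) + W2 (law M X) (law M (S n)))) \<longlonglongrightarrow> 0" by simp
  qed
  \<comment> \<open>This dominates the gradient at every approximation. The 3 comes from bounding
    \<open>X - S n\<close> by \<open>norm (X \<omega>)\<close> plus the factor 2 of the simple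
    approximation.\<close>
  define R where "R \<omega> = norm (G (law M X) (X \<omega>)) + L / 2 * (3 * norm (X \<omega>) + K)" for \<omega>
  have sR: "square_integrable M R"
  proof -
    have n: "square_integrable M (\<lambda>\<omega>. norm (Y \<omega>))" if "square_integrable M Y" for Y :: "'b \<Rightarrow> 'a"
      using that by (auto simp: square_integrable_def)
    have "R = (\<lambda>\<omega>. norm (G (law M X) (X \<omega>)) + (3 * L / 2) *\<^sub>R norm (X \<omega>) + L / 2 * K)"
      by (auto simp: R_def algebra_simps)
    then show ?thesis
      by (simp only:) (intro square_integrable_add square_integrable_scaleR square_integrable_const n
        G_law_square_integrable M X finite_measure_axioms)
  qed
  show ?thesis
  proof (rule that[OF S(1) T(1)])
    show "(\<lambda>n. F (law M (S n))) \<longlonglongrightarrow> F (law M X)"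
      by (rule F_continuous[OF P2X P2S WS])
    show "(\<lambda>n. F (law M (\<lambda>\<omega>. S n \<omega> + T n \<omega>))) \<longlonglongrightarrow> F (law M (\<lambda>\<omega>. X \<omega> + V \<omega>))"
      by (rule F_continuous[OF law_in_P2[OF M sXV] law_in_P2[OF M sST] WST])
    show "(\<lambda>n. \<integral>\<omega>. G (law M (S n)) (S n \<omega>) \<bullet> T n \<omega> \<partial>M) \<longlonglongrightarrow> (\<integral>\<omega>. G (law M X) (X \<omega>) \<bullet> V \<omega> \<partial>M)"
    proof (rule integral_dominated_convergence[where w="\<lambda>\<omega>. R \<omega> * (2 * norm (V \<omega>))"])
      have "square_integrable M (\<lambda>\<omega>. 2 *\<^sub>R norm (V \<omega>))"
        using V by (intro square_integrable_scaleR) (auto simp: square_integrable_def)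
      from square_integrable_inner[OF sR this]
      show "integrable M (\<lambda>\<omega>. R \<omega> * (2 * norm (V \<omega>)))" by simp
      show "AE \<omega> in M. (\<lambda>n. G (law M (S n)) (S n \<omega>) \<bullet> T n \<omega>) \<longlonglongrightarrow> G (law M X) (X \<omega>) \<bullet> V \<omega>"
        by (intro AE_I2 tendsto_inner GS T(2))
      show "AE \<omega> in M. norm (G (law M (S n)) (S n \<omega>) \<bullet> T n \<omega>) \<le> R \<omega> * (2 * norm (V \<omega>))" for n
      proof (rule AE_I2)
        fix \<omega> assume w: "\<omega> \<in> space M"
        have "norm (G (law M (S n)) (S n \<omega>)) \<le> norm (G (law M X) (X \<omega>))
            + norm (G (law M X) (X \<omega>) - G (law M (S n)) (S n \<omega>))"
          by (metis norm_minus_commute norm_triangle_sub)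
        also have "\<dots> \<le> norm (G (law M X) (X \<omega>)) + L / 2 * (norm (X \<omega> - S n \<omega>) + W2 (law M X) (law M (S n)))"
          using lip[of \<omega> n] by simp
        also have "\<dots> \<le> R \<omega>"
          unfolding R_def using dX[OF w, of n] K[of n] L_pos
          by (intro add_left_mono mult_left_mono add_mono) auto
        finally have "norm (G (law M (S n)) (S n \<omega>)) * norm (T n \<omega>) \<le> R \<omega> * (2 * norm (V \<omega>))"
          using T(3)[OF w, of n] by (intro mult_mono) (auto intro: order_trans[OF norm_ge_zero])
        then show "norm (G (law M (S n)) (S n \<omega>) \<bullet> T n \<omega>) \<le> R \<omega> * (2 * norm (V \<omega>))"
          using Cauchy_Schwarz_ineq2[of "G (law M (S n)) (S n \<omega>)" "T n \<omega>"] by simp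
      qed
    qed measurable
    show "(\<lambda>n. \<integral>\<omega>. (norm (T n \<omega>))\<^sup>2 \<partial>M) \<longlonglongrightarrow> (\<integral>\<omega>. (norm (V \<omega>))\<^sup>2 \<partial>M)"
    proof (rule integral_dominated_convergence[where w="\<lambda>\<omega>. (2 * norm (V \<omega>))\<^sup>2"])
      show "integrable M (\<lambda>\<omega>. (2 * norm (V \<omega>))\<^sup>2)"
        using square_integrableD(2)[OF V] by (simp add: power_mult_distrib)
      show "AE \<omega> in M. (\<lambda>n. (norm (T n \<omega>))\<^sup>2) \<longlonglongrightarrow> (norm (V \<omega>))\<^sup>2"
        by (intro AE_I2 tendsto_intros T(2))
      show "AE \<omega> in M. norm ((norm (T n \<omega>))\<^sup>2) \<le> (2 * norm (V \<omega>))\<^sup>2" for n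
        using power_mono[OF T(3) norm_ge_zero, of _ n 2] by (intro AE_I2) simp
    qed measurable
  qed
qed

section \<open>Smoothness and convexity inequalities for arbitrary square integrable
  displacements\<close>

lemma descent:
  fixes X V :: "'b \<Rightarrow> 'a"
  assumes M: "prob_space M" and X: "square_integrable M X" and V: "square_integrable M V"
  shows "F (law M (\<lambda>\<omega>. X \<omega> + V \<omega>)) \<le>
    F (law M X) + (\<integral>\<omega>. G (law M X) (X \<omega>) \<bullet> V \<omega> \<partial>M) + L / 2 * (\<integral>\<omega>. (norm (V \<omega>))\<^sup>2 \<partial>M)"
proof -
  obtain S T where S: "\<And>n. simple_function M (S n)" "\<And>n. simple_function M (T n)"
    and lim: "(\<lambda>n. F (law M (S n))) \<longlonglongrightarrow> F (law M X)"
    "(\<lambda>n. F (law M (\<lambda>\<omega>. S n \<omega> + T n \<omega>))) \<longlonglongrightarrow> F (law M (\<lambda>\<omega>. X \<omega> + V \<omega>))"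
    "(\<lambda>n. \<integral>\<omega>. G (law M (S n)) (S n \<omega>) \<bullet> T n \<omega> \<partial>M) \<longlonglongrightarrow> (\<integral>\<omega>. G (law M X) (X \<omega>) \<bullet> V \<omega> \<partial>M)"
    "(\<lambda>n. \<integral>\<omega>. (norm (T n \<omega>))\<^sup>2 \<partial>M) \<longlonglongrightarrow> (\<integral>\<omega>. (norm (V \<omega>))\<^sup>2 \<partial>M)"
    by (fact simple_approximation[OF M X V])
  show ?thesis
    by (rule LIMSEQ_le[OF lim(2) tendsto_add[OF tendsto_add[OF lim(1,3)] tendsto_mult_left[OF lim(4)]]])
      (use simple_descent[OF M S] in blast)
qed

text \<open>With \<open>V\<close> a difference of two variables, this compares \<open>F\<close> at
  their laws through whatever joint law they have, which is what makes a fixed minimiser usable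
  along the whole iteration.\<close>

lemma support:
  fixes X V :: "'b \<Rightarrow> 'a"
  assumes M: "prob_space M" and X: "square_integrable M X" and V: "square_integrable M V"
    and conv: "geodesically_convex m F"
  shows "F (law M X) + (\<integral>\<omega>. G (law M X) (X \<omega>) \<bullet> V \<omega> \<partial>M) + m / 2 * (\<integral>\<omega>. (norm (V \<omega>))\<^sup>2 \<partial>M)
    \<le> F (law M (\<lambda>\<omega>. X \<omega> + V \<omega>))"
proof -
  obtain S T where S: "\<And>n. simple_function M (S n)" "\<And>n. simple_function M (T n)"
    and lim: "(\<lambda>n. F (law M (S n))) \<longlonglongrightarrow> F (law M X)"
    "(\<lambda>n. F (law M (\<lambda>\<omega>. S n \<omega> + T n \<omega>))) \<longlonglongrightarrow> F (law M (\<lambda>\<omega>. X \<omega> + V \<omega>))"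
    "(\<lambda>n. \<integral>\<omega>. G (law M (S n)) (S n \<omega>) \<bullet> T n \<omega> \<partial>M) \<longlonglongrightarrow> (\<integral>\<omega>. G (law M X) (X \<omega>) \<bullet> V \<omega> \<partial>M)"
    "(\<lambda>n. \<integral>\<omega>. (norm (T n \<omega>))\<^sup>2 \<partial>M) \<longlonglongrightarrow> (\<integral>\<omega>. (norm (V \<omega>))\<^sup>2 \<partial>M)"
    by (fact simple_approximation[OF M X V])
  show ?thesis
    by (rule LIMSEQ_le[OF tendsto_add[OF tendsto_add[OF lim(1,3)] tendsto_mult_left[OF lim(4)]] lim(2)])
      (use simple_support[OF M S conv] in blast)
qed

text \<open>Swapping two atoms is a displacement that does not change the law, so only the
  pointwise half of the Lipschitz bound limits the convexity modulus.\<close>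

lemma convexity_modulus_le:
  assumes conv: "geodesically_convex m F"
  shows "m \<le> L / 2"
proof -
  obtain a :: 'a where a: "norm a = 1" using vector_choose_size[of 1] by auto
  \<comment> \<open>A fair coin gives the two atoms \<open>a\<close> and 0 equal mass, so exchanging
    them preserves the law.\<close>
  let ?M = "measure_pmf (pmf_of_set (UNIV :: bool set))"
  define X where "X = (\<lambda>b. if b then a else 0)"
  define V where "V = (\<lambda>b. if b then - a else a)"
  have M: "prob_space ?M" by (rule prob_space_measure_pmf)
  have simple: "simple_function ?M f" for f :: "bool \<Rightarrow> 'a"
    by (simp add: simple_function_def)
  have sq: "square_integrable ?M f" for f :: "bool \<Rightarrow> 'a"
    using simple_function_square_integrable[OF _ simple] M prob_space.finite_measure by blast
  have "range Not = UNIV" by (rule surjI[of _ Not]) simp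
  then have "map_pmf Not (pmf_of_set UNIV) = pmf_of_set (UNIV :: bool set)"
    by (subst map_pmf_of_set_inj) (auto simp: inj_def)
  then have "distr ?M (count_space UNIV) Not = ?M" by (metis map_pmf_rep_eq)
  then have "law ?M X = law (distr ?M (count_space UNIV) Not) X" by simp
  also have "\<dots> = law ?M (\<lambda>b. X b + V b)"
    by (subst distr_distr) (auto simp: X_def V_def comp_def intro!: distr_cong)
  finally have eq: "law ?M (\<lambda>b. X b + V b) = law ?M X" ..
  define g where "g = G (law ?M X)"
  have "(\<integral>b. g (X b) \<bullet> V b \<partial>?M) = (g 0 - g a) \<bullet> a / 2"
    by (subst integral_pmf_of_set) (auto simp: X_def V_def UNIV_bool inner_diff_left)
  moreover have "(\<integral>b. (norm (V b))\<^sup>2 \<partial>?M) = 1"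
    by (subst integral_pmf_of_set) (auto simp: V_def UNIV_bool a)
  \<comment> \<open>The two values of \<open>F\<close> in the support inequality coincide and
    cancel, leaving the modulus against the monotonicity of one fixed gradient field between
    \<open>a\<close> and 0.\<close>
  ultimately have "m / 2 \<le> (g a - g 0) \<bullet> a / 2"
    using support[OF M sq sq conv, of X V] unfolding eq by (simp add: g_def[symmetric] inner_diff_left)
  also have "\<dots> \<le> norm (g a - g 0) * norm a / 2" using norm_cauchy_schwarz by simp
  also have "\<dots> \<le> L / 2 * (norm (a - 0) + W2 (law ?M X) (law ?M X)) / 2"
    using lipschitz[OF law_in_P2[OF M sq] law_in_P2[OF M sq], of X a X 0] by (simp add: g_def a)
  also have "W2 (law ?M X) (law ?M X) \<le> 0"
    using W2_law_le[OF M, of X X] by simp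
  finally show ?thesis using L_pos a by simp
qed

text \<open>Descent from \<open>Y\<close> with step \<open>1 / L\<close>, the minimiser of the
  quadratic upper model, gains \<open>1 / (2 * L)\<close> times the squared gradient; the support
  inequality at \<open>Y\<close> towards \<open>Z\<close> accounts for the rest. Keeping a single
  integral allows the later energy estimates to be checked pointwise.\<close>

lemma gradient_step:
  fixes Y Z :: "'b \<Rightarrow> 'a"
  assumes M: "prob_space M" and Y: "square_integrable M Y" and Z: "square_integrable M Z"
    and conv: "geodesically_convex m F"
  shows "F (law M (\<lambda>\<omega>. Y \<omega> - (1 / L) *\<^sub>R G (law M Y) (Y \<omega>))) - F (law M Z) \<le>
    (\<integral>\<omega>. G (law M Y) (Y \<omega>) \<bullet> (Y \<omega> - Z \<omega>) - 1 / (2 * L) * (norm (G (law M Y) (Y \<omega>)))\<^sup>2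
      - m / 2 * (norm (Y \<omega> - Z \<omega>))\<^sup>2 \<partial>M)"
proof -
  define g where "g \<omega> = G (law M Y) (Y \<omega>)" for \<omega>
  have g: "square_integrable M g" unfolding g_def by (rule G_law_square_integrable[OF M Y])
  have V: "square_integrable M (\<lambda>\<omega>. - (1 / L) *\<^sub>R g \<omega>)" and YZ: "square_integrable M (\<lambda>\<omega>. Z \<omega> - Y \<omega>)"
    and YZ': "square_integrable M (\<lambda>\<omega>. Y \<omega> - Z \<omega>)"
    using g Y Z by (auto intro: square_integrable_intros simp del: scaleR_minus_left)
  have "F (law M (\<lambda>\<omega>. Y \<omega> - (1 / L) *\<^sub>R g \<omega>)) \<le>
      F (law M Y) - 1 / L * (\<integral>\<omega>. (norm (g \<omega>))\<^sup>2 \<partial>M) + L / 2 * ((1 / L)\<^sup>2 * (\<integral>\<omega>. (norm (g \<omega>))\<^sup>2 \<partial>M))"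
    using descent[OF M Y V] by (simp add: g_def[symmetric] power_mult_distrib power_divide power2_norm_eq_inner)
  also have "\<dots> = F (law M Y) - 1 / (2 * L) * (\<integral>\<omega>. (norm (g \<omega>))\<^sup>2 \<partial>M)"
    using L_pos by (simp add: power2_eq_square field_simps)
  finally have d: "F (law M (\<lambda>\<omega>. Y \<omega> - (1 / L) *\<^sub>R g \<omega>)) \<le> \<dots>" .
  have s: "F (law M Y) + (\<integral>\<omega>. g \<omega> \<bullet> (Z \<omega> - Y \<omega>) \<partial>M) + m / 2 * (\<integral>\<omega>. (norm (Y \<omega> - Z \<omega>))\<^sup>2 \<partial>M) \<le> F (law M Z)"
    using support[OF M Y YZ conv] by (simp add: g_def[symmetric] norm_minus_commute)
  have "(\<integral>\<omega>. g \<omega> \<bullet> (Z \<omega> - Y \<omega>) \<partial>M) = - (\<integral>\<omega>. g \<omega> \<bullet> (Y \<omega> - Z \<omega>) \<partial>M)"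
    by (simp add: inner_diff_right flip: integral_minus)
  with d s have "F (law M (\<lambda>\<omega>. Y \<omega> - (1 / L) *\<^sub>R g \<omega>)) - F (law M Z) \<le>
    (\<integral>\<omega>. g \<omega> \<bullet> (Y \<omega> - Z \<omega>) \<partial>M) - 1 / (2 * L) * (\<integral>\<omega>. (norm (g \<omega>))\<^sup>2 \<partial>M)
      - m / 2 * (\<integral>\<omega>. (norm (Y \<omega> - Z \<omega>))\<^sup>2 \<partial>M)" by linarith
  also have "\<dots> = (\<integral>\<omega>. g \<omega> \<bullet> (Y \<omega> - Z \<omega>) - 1 / (2 * L) * (norm (g \<omega>))\<^sup>2
      - m / 2 * (norm (Y \<omega> - Z \<omega>))\<^sup>2 \<partial>M)"
    using square_integrableD(2)[OF g] square_integrableD(2)[OF YZ'] square_integrable_inner[OF g YZ'] by simp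
  finally show ?thesis by (simp add: g_def)
qed

end

section \<open>The accelerated iteration\<close>

text \<open>Here \<open>e\<close> stands for \<open>y - x\<close>, \<open>d\<close> for
  \<open>y - z\<close>, \<open>g\<close> for the gradient at \<open>y\<close>, and
  \<open>L * r\<^sup>2\<close> is the convexity modulus. All terms with \<open>g\<close> or
  \<open>d\<close> balance exactly; the slack is a nonnegative multiple of the squared norm of
  \<open>e\<close>.\<close>

lemma accelerated_identity_strong:
  fixes d e g :: "'a::real_inner"
  assumes "L > 0" "0 < r" "r \<le> 1"
  shows "(1 - r) * (g \<bullet> e - 1 / (2 * L) * (norm g)\<^sup>2 - L * r\<^sup>2 / 2 * (norm e)\<^sup>2)
      + r * (g \<bullet> d - 1 / (2 * L) * (norm g)\<^sup>2 - L * r\<^sup>2 / 2 * (norm d)\<^sup>2)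
    \<le> (1 - r) * (L * r\<^sup>2 / 2 * (norm (d + (1 / r) *\<^sub>R e))\<^sup>2)
      - L * r\<^sup>2 / 2 * (norm (d - e + (1 / r) *\<^sub>R (e - (1 / L) *\<^sub>R g)))\<^sup>2"
    (is "?l \<le> ?r")
proof -
  have 1: "(norm (d + (1 / r) *\<^sub>R e))\<^sup>2 = d \<bullet> d + 2 / r * (d \<bullet> e) + (1 / r)\<^sup>2 * (e \<bullet> e)"
    unfolding power2_norm_eq_inner
    by (simp add: inner_simps inner_commute[of e d] power2_eq_square algebra_simps add_divide_distrib)
  have 2: "(norm (d - e + (1 / r) *\<^sub>R (e - (1 / L) *\<^sub>R g)))\<^sup>2
    = d \<bullet> d + (1 / r - 1)\<^sup>2 * (e \<bullet> e) + (1 / (r * L))\<^sup>2 * (g \<bullet> g) + 2 * (1 / r - 1) * (d \<bullet> e)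
      - 2 * (1 / (r * L)) * (g \<bullet> d) - 2 * (1 / r - 1) * (1 / (r * L)) * (g \<bullet> e)"
    unfolding power2_norm_eq_inner
    by (simp add: inner_simps inner_commute[of e d] inner_commute[of e g] inner_commute[of d g]
        power2_eq_square algebra_simps)
  have "?r - ?l = L / 2 * (1 - r) * r * (1 + r) * (e \<bullet> e)"
    unfolding 1 2 unfolding power2_norm_eq_inner using assms
    by (simp add: divide_simps) (simp add: power2_eq_square algebra_simps)
  also have "\<dots> \<ge> 0" using assms by simp
  finally show ?thesis by simp
qed

text \<open>The right side is \<open>L / 2\<close> times the difference of the squared norms of
  \<open>p\<close> and \<open>p - (a / L) g\<close>, where \<open>p = d - e + a e\<close>; expanding
  it gives the weights on the left. Vectors are named as in the strongly convex case.\<close>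

lemma accelerated_identity_convex:
  fixes d e g :: "'a::real_inner"
  assumes "L > 0"
  shows "(a\<^sup>2 - a) * (g \<bullet> e - 1 / (2 * L) * (norm g)\<^sup>2) + a * (g \<bullet> d - 1 / (2 * L) * (norm g)\<^sup>2)
    = L / 2 * (norm (d - e + a *\<^sub>R e))\<^sup>2 - L / 2 * (norm (d - e + a *\<^sub>R (e - (1 / L) *\<^sub>R g)))\<^sup>2"
  unfolding power2_norm_eq_inner using assms
  by (simp add: inner_simps inner_commute[of e d] inner_commute[of e g] inner_commute[of d g])
    (simp add: field_simps power2_eq_square)

context lipschitz_wasserstein_gradient
begin

lemma gradient_step_integrable:
  assumes "square_integrable M g" "square_integrable M u"
  shows "integrable M (\<lambda>\<omega>. g \<omega> \<bullet> u \<omega> - c * (norm (g \<omega>))\<^sup>2 - c' * (norm (u \<omega>))\<^sup>2)"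
  using square_integrable_inner[OF assms] assms[THEN square_integrableD(2)] by simp

text \<open>The energy is the gap plus half the modulus times the mean square distance of
  \<open>z\<close> to the point extrapolated from \<open>x\<close> along the last increment.
  \<open>z\<close> is an arbitrary comparison variable on the same space.\<close>

lemma accelerated_step_strong:
  fixes M :: "'b measure" and x w z :: "'b \<Rightarrow> 'a" and r :: real
  defines "y \<equiv> \<lambda>\<omega>. x \<omega> + ((1 - r) / (1 + r)) *\<^sub>R w \<omega>"
  defines "x' \<equiv> \<lambda>\<omega>. y \<omega> - (1 / L) *\<^sub>R G (law M y) (y \<omega>)"
  assumes M: "prob_space M" and x: "square_integrable M x" and w: "square_integrable M w"
    and z: "square_integrable M z" and conv: "geodesically_convex (L * r\<^sup>2) F" and r: "0 < r" "r \<le> 1"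
  shows "F (law M x') - F (law M z) + L * r\<^sup>2 / 2 * (\<integral>\<omega>. (norm (x' \<omega> + (1 / r - 1) *\<^sub>R (x' \<omega> - x \<omega>) - z \<omega>))\<^sup>2 \<partial>M)
    \<le> (1 - r) * (F (law M x) - F (law M z) + L * r\<^sup>2 / 2 * (\<integral>\<omega>. (norm (x \<omega> + (1 / r - 1) *\<^sub>R w \<omega> - z \<omega>))\<^sup>2 \<partial>M))"
proof -
  define g where "g \<omega> = G (law M y) (y \<omega>)" for \<omega>
  have y: "square_integrable M y" unfolding y_def by (intro square_integrable_intros x w)
  have g: "square_integrable M g" unfolding g_def by (rule G_law_square_integrable[OF M y])
  have x': "square_integrable M x'" unfolding x'_def g_def[symmetric] by (intro square_integrable_intros y g)
  define \<phi> where "\<phi> u \<omega> = g \<omega> \<bullet> (y \<omega> - u \<omega>) - 1 / (2 * L) * (norm (g \<omega>))\<^sup>2 - L * r\<^sup>2 / 2 * (norm (y \<omega> - u \<omega>))\<^sup>2" for u \<omega>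
  have step: "F (law M x') - F (law M u) \<le> (\<integral>\<omega>. \<phi> u \<omega> \<partial>M)" if "square_integrable M u" for u
    using gradient_step[OF M y that conv] by (simp add: \<phi>_def x'_def g_def)
  have int: "integrable M (\<phi> u)" if "square_integrable M u" for u
    unfolding \<phi>_def[abs_def] by (rule gradient_step_integrable[OF g square_integrable_diff[OF y that]])
  define p where "p \<omega> = x \<omega> + (1 / r - 1) *\<^sub>R w \<omega> - z \<omega>" for \<omega>
  define p' where "p' \<omega> = x' \<omega> + (1 / r - 1) *\<^sub>R (x' \<omega> - x \<omega>) - z \<omega>" for \<omega>
  have "square_integrable M p" "square_integrable M p'"
    unfolding p_def p'_def by (intro square_integrable_intros x w z x')+
  then have ip: "integrable M (\<lambda>\<omega>. (norm (p \<omega>))\<^sup>2)" "integrable M (\<lambda>\<omega>. (norm (p' \<omega>))\<^sup>2)"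
    by (auto dest: square_integrableD)
  have pw: "(1 - r) * \<phi> x \<omega> + r * \<phi> z \<omega> \<le> (1 - r) * (L * r\<^sup>2 / 2 * (norm (p \<omega>))\<^sup>2) - L * r\<^sup>2 / 2 * (norm (p' \<omega>))\<^sup>2" for \<omega>
  proof -
    let ?e = "y \<omega> - x \<omega>" and ?d = "y \<omega> - z \<omega>"
    \<comment> \<open>This relation is what singles out the momentum coefficient
      \<open>(1 - r) / (1 + r)\<close>: it converts the multiple of the increment \<open>w\<close>
      in the energy into a multiple of \<open>y - x\<close>.\<close>
    have c: "(1 / r - 1) = ((1 - r) / (1 + r)) * (1 + 1 / r)"
      using r by (simp add: divide_simps)
    define q where "q = (1 / L) *\<^sub>R g \<omega>"
    have "?e + (1 / r) *\<^sub>R ?e = (1 + 1 / r) *\<^sub>R ?e" by (simp add: scaleR_add_left)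
    also have "\<dots> = (1 / r - 1) *\<^sub>R w \<omega>" unfolding c by (simp add: y_def mult.commute)
    finally have p: "p \<omega> = ?d + (1 / r) *\<^sub>R ?e" by (simp add: p_def algebra_simps)
    have x'q: "x' \<omega> = y \<omega> - q" by (simp add: x'_def g_def q_def)
    have p': "p' \<omega> = ?d - ?e + (1 / r) *\<^sub>R (?e - q)"
      unfolding p'_def x'q by (simp add: algebra_simps)
    show ?thesis
      using accelerated_identity_strong[OF L_pos r, of "g \<omega>" ?e ?d]
      unfolding p p' q_def by (simp add: \<phi>_def)
  qed
  \<comment> \<open>The gradient step is compared with \<open>x\<close> at weight
    \<open>1 - r\<close> and with \<open>z\<close> at weight \<open>r\<close>. The weights sum to 1,
    so the new gap appears once and the old gap with the contraction factor.\<close>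
  have "(1 - r) * (F (law M x') - F (law M x)) + r * (F (law M x') - F (law M z))
      \<le> (1 - r) * (\<integral>\<omega>. \<phi> x \<omega> \<partial>M) + r * (\<integral>\<omega>. \<phi> z \<omega> \<partial>M)"
    using r step[OF x] step[OF z] by (intro add_mono mult_left_mono) auto
  also have "\<dots> = (\<integral>\<omega>. (1 - r) * \<phi> x \<omega> + r * \<phi> z \<omega> \<partial>M)"
    using int[OF x] int[OF z] by simp
  also have "\<dots> \<le> (\<integral>\<omega>. (1 - r) * (L * r\<^sup>2 / 2 * (norm (p \<omega>))\<^sup>2) - L * r\<^sup>2 / 2 * (norm (p' \<omega>))\<^sup>2 \<partial>M)"
    using int[OF x] int[OF z] ip pw by (intro integral_mono) auto
  also have "\<dots> = (1 - r) * (L * r\<^sup>2 / 2 * (\<integral>\<omega>. (norm (p \<omega>))\<^sup>2 \<partial>M)) - L * r\<^sup>2 / 2 * (\<integral>\<omega>. (norm (p' \<omega>))\<^sup>2 \<partial>M)"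
    using ip by simp
  finally show ?thesis unfolding p_def[symmetric] p'_def[symmetric] by (simp add: field_simps)
qed

text \<open>The comparisons with \<open>x\<close> and \<open>z\<close> get weights
  \<open>a\<^sup>2 - a\<close> and \<open>a\<close>, which sum to \<open>a\<^sup>2\<close>. The
  condition \<open>a\<^sup>2 - a = b\<^sup>2\<close> makes the old gap appear with precisely the
  weight it had in the previous energy, so the energies telescope.\<close>

lemma accelerated_step_convex:
  fixes M :: "'b measure" and x w z :: "'b \<Rightarrow> 'a" and a b :: real
  defines "y \<equiv> \<lambda>\<omega>. x \<omega> + ((b - 1) / a) *\<^sub>R w \<omega>"
  defines "x' \<equiv> \<lambda>\<omega>. y \<omega> - (1 / L) *\<^sub>R G (law M y) (y \<omega>)"
  assumes M: "prob_space M" and x: "square_integrable M x" and w: "square_integrable M w"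
    and z: "square_integrable M z" and conv: "geodesically_convex 0 F"
    and a: "a \<ge> 1" and ab: "a\<^sup>2 - a = b\<^sup>2"
  shows "a\<^sup>2 * (F (law M x') - F (law M z)) + L / 2 * (\<integral>\<omega>. (norm (x' \<omega> + (a - 1) *\<^sub>R (x' \<omega> - x \<omega>) - z \<omega>))\<^sup>2 \<partial>M)
    \<le> b\<^sup>2 * (F (law M x) - F (law M z)) + L / 2 * (\<integral>\<omega>. (norm (x \<omega> + (b - 1) *\<^sub>R w \<omega> - z \<omega>))\<^sup>2 \<partial>M)"
proof -
  define g where "g \<omega> = G (law M y) (y \<omega>)" for \<omega>
  have y: "square_integrable M y" unfolding y_def by (intro square_integrable_intros x w)
  have g: "square_integrable M g" unfolding g_def by (rule G_law_square_integrable[OF M y])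
  have x': "square_integrable M x'" unfolding x'_def g_def[symmetric] by (intro square_integrable_intros y g)
  \<comment> \<open>The vanishing last term keeps the shape of \<open>gradient_step\<close> at
    modulus 0.\<close>
  define \<phi> where "\<phi> u \<omega> = g \<omega> \<bullet> (y \<omega> - u \<omega>) - 1 / (2 * L) * (norm (g \<omega>))\<^sup>2 - 0 / 2 * (norm (y \<omega> - u \<omega>))\<^sup>2" for u \<omega>
  have step: "F (law M x') - F (law M u) \<le> (\<integral>\<omega>. \<phi> u \<omega> \<partial>M)" if "square_integrable M u" for u
    using gradient_step[OF M y that conv] by (simp add: \<phi>_def x'_def g_def)
  have int: "integrable M (\<phi> u)" if "square_integrable M u" for u
    unfolding \<phi>_def[abs_def] by (rule gradient_step_integrable[OF g square_integrable_diff[OF y that]])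
  define p where "p \<omega> = x \<omega> + (b - 1) *\<^sub>R w \<omega> - z \<omega>" for \<omega>
  define p' where "p' \<omega> = x' \<omega> + (a - 1) *\<^sub>R (x' \<omega> - x \<omega>) - z \<omega>" for \<omega>
  have "square_integrable M p" "square_integrable M p'"
    unfolding p_def p'_def by (intro square_integrable_intros x w z x')+
  then have ip: "integrable M (\<lambda>\<omega>. (norm (p \<omega>))\<^sup>2)" "integrable M (\<lambda>\<omega>. (norm (p' \<omega>))\<^sup>2)"
    by (auto dest: square_integrableD)
  have pw: "(a\<^sup>2 - a) * \<phi> x \<omega> + a * \<phi> z \<omega> = L / 2 * (norm (p \<omega>))\<^sup>2 - L / 2 * (norm (p' \<omega>))\<^sup>2" for \<omega>
  proof -
    let ?e = "y \<omega> - x \<omega>" and ?d = "y \<omega> - z \<omega>"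
    define q where "q = (1 / L) *\<^sub>R g \<omega>"
    have "a *\<^sub>R ?e = (b - 1) *\<^sub>R w \<omega>" using a by (simp add: y_def)
    then have p: "p \<omega> = ?d - ?e + a *\<^sub>R ?e" by (simp add: p_def)
    have x'q: "x' \<omega> = y \<omega> - q" by (simp add: x'_def g_def q_def)
    have p': "p' \<omega> = ?d - ?e + a *\<^sub>R (?e - q)"
      unfolding p'_def x'q by (simp add: algebra_simps)
    show ?thesis
      using accelerated_identity_convex[OF L_pos, of a "g \<omega>" ?e ?d]
      unfolding p p' q_def by (simp add: \<phi>_def)
  qed
  have "(a\<^sup>2 - a) * (F (law M x') - F (law M x)) + a * (F (law M x') - F (law M z))
      \<le> (a\<^sup>2 - a) * (\<integral>\<omega>. \<phi> x \<omega> \<partial>M) + a * (\<integral>\<omega>. \<phi> z \<omega> \<partial>M)"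
    using a ab step[OF x] step[OF z] by (intro add_mono mult_left_mono) auto
  also have "\<dots> = (\<integral>\<omega>. (a\<^sup>2 - a) * \<phi> x \<omega> + a * \<phi> z \<omega> \<partial>M)"
    using int[OF x] int[OF z] by simp
  also have "\<dots> = L / 2 * (\<integral>\<omega>. (norm (p \<omega>))\<^sup>2 \<partial>M) - L / 2 * (\<integral>\<omega>. (norm (p' \<omega>))\<^sup>2 \<partial>M)"
    unfolding pw using ip by simp
  finally show ?thesis unfolding p_def[symmetric] p'_def[symmetric] ab[symmetric] by (simp add: algebra_simps)
qed

end

section \<open>Particle representation of the measure-level iteration\<close>

text \<open>A mean-field system: each point moves by its own update, and points interact only
  through the law of the drifted position under \<open>M\<close>, at which the gradient is
  taken.\<close>

primrec nesterov_particle ::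
  "'b measure \<Rightarrow> ('a measure \<Rightarrow> 'a \<Rightarrow> 'a) \<Rightarrow> real \<Rightarrow> (nat \<Rightarrow> real) \<Rightarrow> ('b \<Rightarrow> 'a) \<Rightarrow> nat \<Rightarrow> 'b \<Rightarrow>
    'a::euclidean_space \<times> 'a" where
  "nesterov_particle M G s \<beta> X 0 = (\<lambda>\<omega>. (X \<omega>, 0))"
| "nesterov_particle M G s \<beta> X (Suc k) = (\<lambda>\<omega>.
     let d = (\<lambda>\<omega>. nesterov_drift s (\<beta> (Suc k)) (nesterov_particle M G s \<beta> X k \<omega>))
     in nesterov_momentum s (\<beta> (Suc k)) (G (law M (\<lambda>\<omega>. fst (d \<omega>)))) (d \<omega>))"

lemma nesterov_drift_borel [measurable]:
  "nesterov_drift s b \<in> borel_measurable borel"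
  unfolding nesterov_drift_def case_prod_beta
  by (intro borel_measurable_continuous_onI continuous_intros)

lemma nesterov_momentum_borel:
  assumes [measurable]: "g \<in> borel_measurable borel"
  shows "nesterov_momentum s b g \<in> borel_measurable borel"
  unfolding nesterov_momentum_def case_prod_beta by measurable

text \<open>Agreement on rectangles suffices. It identifies the initial product measure as the joint
  law of a position and a zero velocity.\<close>

lemma pair_return_eq_law:
  fixes X :: "'b \<Rightarrow> 'a::euclidean_space"
  assumes "prob_space M" and [measurable]: "X \<in> borel_measurable M"
  shows "law M X \<Otimes>\<^sub>M return borel (0::'a) = law M (\<lambda>\<omega>. (X \<omega>, 0::'a))"
proof (rule pair_measure_eqI)
  interpret M: prob_space M by fact
  show "sigma_finite_measure (law M X)"
    by (intro prob_space_imp_sigma_finite M.prob_space_distr) measurable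
  show "sigma_finite_measure (return borel (0::'a))"
    by (intro prob_space_imp_sigma_finite prob_space_return) simp
  show "sets (law M X \<Otimes>\<^sub>M return borel (0::'a)) = sets (law M (\<lambda>\<omega>. (X \<omega>, 0::'a)))"
    by (simp add: borel_prod[symmetric] cong: sets_pair_measure_cong)
  fix A B :: "'a set" assume "A \<in> sets (law M X)" "B \<in> sets (return borel 0)"
  then have A[measurable]: "A \<in> sets borel" and B[measurable]: "B \<in> sets borel" by auto
  have "A \<times> B \<in> sets borel" using A B by (rule borel_Times)
  moreover have "(\<lambda>\<omega>. (X \<omega>, 0::'a)) \<in> borel_measurable M" by measurable
  ultimately have "emeasure (law M (\<lambda>\<omega>. (X \<omega>, 0::'a))) (A \<times> B) = emeasure M ((\<lambda>\<omega>. (X \<omega>, 0)) -` (A \<times> B) \<inter> space M)"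
    by (intro emeasure_distr)
  also have "\<dots> = emeasure (law M X) A * emeasure (return borel 0) B"
    by (auto simp: emeasure_distr indicator_def vimage_def split: if_splits)
  finally show "emeasure (law M X) A * emeasure (return borel 0) B
    = emeasure (law M (\<lambda>\<omega>. (X \<omega>, 0::'a))) (A \<times> B)" ..
qed

context lipschitz_wasserstein_gradient
begin

text \<open>Pushforwards compose, so laws follow the particle maps. Square integrability has to be
  carried in the same induction, since measurability and integrability of \<open>G\<close> are known
  only at laws in \<open>P2\<close>.\<close>

lemma nesterov_particle:
  fixes X :: "'b \<Rightarrow> 'a" and \<beta> :: "nat \<Rightarrow> real" and s :: real
  assumes M: "prob_space M" and X: "square_integrable M X"
  defines "P \<equiv> nesterov_particle M G s \<beta> X"
  shows "square_integrable M (\<lambda>\<omega>. fst (P k \<omega>)) \<and> square_integrable M (\<lambda>\<omega>. snd (P k \<omega>)) \<and>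
    nesterov G s \<beta> (law M X) k = law M (P k)"
proof (induction k)
  case 0
  show ?case
    using X pair_return_eq_law[OF M square_integrableD(1)[OF X]]
      square_integrable_const[OF prob_space.finite_measure[OF M], of 0] by (simp add: P_def)
next
  case (Suc k)
  let ?b = "\<beta> (Suc k)"
  define d where "d \<omega> = nesterov_drift s ?b (P k \<omega>)" for \<omega>
  define g where "g = G (law M (\<lambda>\<omega>. fst (d \<omega>)))"
  have PS: "P (Suc k) = (\<lambda>\<omega>. nesterov_momentum s ?b g (d \<omega>))"
    by (simp add: P_def d_def[abs_def] g_def Let_def)
  have fd: "(\<lambda>\<omega>. fst (d \<omega>)) = (\<lambda>\<omega>. fst (P k \<omega>) + (sqrt s * (1 + ?b)) *\<^sub>R snd (P k \<omega>))"
    and sd: "(\<lambda>\<omega>. snd (d \<omega>)) = (\<lambda>\<omega>. snd (P k \<omega>))"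
    by (simp_all add: d_def nesterov_drift_def case_prod_beta)
  have sqd: "square_integrable M (\<lambda>\<omega>. fst (d \<omega>))" "square_integrable M (\<lambda>\<omega>. snd (d \<omega>))"
    unfolding fd sd using Suc by (auto intro!: square_integrable_intros)
  have sqg: "square_integrable M (\<lambda>\<omega>. g (fst (d \<omega>)))"
    unfolding g_def by (rule G_law_square_integrable[OF M sqd(1)])
  have g_meas: "g \<in> borel_measurable borel"
    unfolding g_def by (rule G_measurable[OF law_in_P2[OF M sqd(1)]])
  have "(\<lambda>\<omega>. fst (P (Suc k) \<omega>)) = (\<lambda>\<omega>. fst (d \<omega>) - (sqrt s * ?b) *\<^sub>R snd (d \<omega>))"
    "(\<lambda>\<omega>. snd (P (Suc k) \<omega>)) = (\<lambda>\<omega>. ?b *\<^sub>R snd (d \<omega>) - sqrt s *\<^sub>R g (fst (d \<omega>)))"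
    by (simp_all add: PS nesterov_momentum_def case_prod_beta)
  then have sq: "square_integrable M (\<lambda>\<omega>. fst (P (Suc k) \<omega>))" "square_integrable M (\<lambda>\<omega>. snd (P (Suc k) \<omega>))"
    using sqd sqg by (auto intro!: square_integrable_intros)
  have "(\<lambda>\<omega>. (fst (P k \<omega>), snd (P k \<omega>))) \<in> borel_measurable M"
    using Suc by (intro borel_measurable_Pair) (auto dest: square_integrableD)
  then have Pm [measurable]: "P k \<in> borel_measurable M" by simp
  have dm [measurable]: "d \<in> borel_measurable M" unfolding d_def[abs_def] by measurable
  have eq: "distr (law M (P k)) borel (nesterov_drift s ?b) = law M d"
    by (simp add: distr_distr comp_def d_def[abs_def])
  have eq2: "distr (law M d) borel fst = law M (\<lambda>\<omega>. fst (d \<omega>))"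
    by (simp add: distr_distr comp_def)
  have eq3: "distr (law M d) borel (nesterov_momentum s ?b g) = law M (P (Suc k))"
    using nesterov_momentum_borel[OF g_meas, of s ?b] by (simp add: distr_distr comp_def PS)
  have "nesterov G s \<beta> (law M X) (Suc k) = law M (P (Suc k))"
    using Suc by (simp add: nesterov_step_def eq eq2 eq3 Let_def g_def[symmetric])
  with sq show ?case by simp
qed

text \<open>The position after step \<open>k + 1\<close> is \<open>x k\<close>, the momentum part of that step only undoing the
  look-ahead of the drift; hence the index shift, and \<open>w k\<close> is the last increment of the positions.\<close>

lemma nesterov_trajectory:
  fixes X :: "'b \<Rightarrow> 'a" and \<beta> :: "nat \<Rightarrow> real" and s :: real
  assumes M: "prob_space M" and X: "square_integrable M X" and s: "s \<ge> 0"
  obtains x w :: "nat \<Rightarrow> 'b \<Rightarrow> 'a" where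
    "\<And>k. square_integrable M (x k)" "\<And>k. square_integrable M (w k)"
    "x 0 = X" "\<And>k. nesterov_position G s \<beta> (law M X) (Suc k) = law M (x k)"
    "\<And>k. x (Suc k) = (\<lambda>\<omega>. x k \<omega> + \<beta> (Suc k) *\<^sub>R w k \<omega>
      - s *\<^sub>R G (law M (\<lambda>\<omega>. x k \<omega> + \<beta> (Suc k) *\<^sub>R w k \<omega>)) (x k \<omega> + \<beta> (Suc k) *\<^sub>R w k \<omega>))"
    "\<And>k. w (Suc k) = (\<lambda>\<omega>. x (Suc k) \<omega> - x k \<omega>)"
proof -
  define P where "P = nesterov_particle M G s \<beta> X"
  note P = nesterov_particle[OF M X, where s=s and \<beta>=\<beta>, folded P_def]
  define x where "x k \<omega> = fst (P (Suc k) \<omega>)" for k \<omega>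
  \<comment> \<open>Rescaling the velocity by \<open>sqrt s\<close> turns it into a displacement; it
    is 0 at the start, so \<open>x 0\<close> is the initial position.\<close>
  define w where "w k \<omega> = sqrt s *\<^sub>R snd (P k \<omega>)" for k \<omega>
  \<comment> \<open>Drift adds \<open>1 + \<beta>\<close> times the scaled velocity and the momentum
    map takes \<open>\<beta>\<close> times it back, so one full unit remains.\<close>
  have x_eq: "x k \<omega> = fst (P k \<omega>) + w k \<omega>" for k \<omega>
    by (simp add: x_def w_def P_def nesterov_momentum_def nesterov_drift_def case_prod_beta Let_def algebra_simps)
  have drift: "fst (nesterov_drift s (\<beta> (Suc k)) (P k \<omega>)) = x k \<omega> + \<beta> (Suc k) *\<^sub>R w k \<omega>" for k \<omega>
    by (simp add: x_eq) (simp add: w_def nesterov_drift_def case_prod_beta algebra_simps)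
  have w_Suc: "w (Suc k) \<omega> = \<beta> (Suc k) *\<^sub>R w k \<omega>
      - s *\<^sub>R G (law M (\<lambda>\<omega>. x k \<omega> + \<beta> (Suc k) *\<^sub>R w k \<omega>)) (x k \<omega> + \<beta> (Suc k) *\<^sub>R w k \<omega>)" for k \<omega>
  proof -
    let ?g = "G (law M (\<lambda>\<omega>. x k \<omega> + \<beta> (Suc k) *\<^sub>R w k \<omega>)) (x k \<omega> + \<beta> (Suc k) *\<^sub>R w k \<omega>)"
    have "snd (P (Suc k) \<omega>) = \<beta> (Suc k) *\<^sub>R snd (P k \<omega>) - sqrt s *\<^sub>R ?g"
      unfolding drift[symmetric]
      by (simp add: P_def nesterov_momentum_def case_prod_beta Let_def) (simp add: nesterov_drift_def case_prod_beta)
    then have "w (Suc k) \<omega> = sqrt s *\<^sub>R (\<beta> (Suc k) *\<^sub>R snd (P k \<omega>) - sqrt s *\<^sub>R ?g)"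
      by (simp only: w_def)
    also have "\<dots> = \<beta> (Suc k) *\<^sub>R (sqrt s *\<^sub>R snd (P k \<omega>)) - s *\<^sub>R ?g"
      using s by (simp add: scaleR_diff_right mult.commute)
    finally show ?thesis by (simp only: w_def)
  qed
  show ?thesis
  proof (rule that[of x w])
    show sx: "square_integrable M (x k)" for k using P[of "Suc k"] by (simp add: x_def[abs_def])
    show sw: "square_integrable M (w k)" for k
      using P[of k] by (simp add: w_def[abs_def] square_integrable_scaleR)
    show "x 0 = X" by (rule ext) (simp add: x_eq, simp add: w_def P_def)
    have "P k \<in> borel_measurable M" for k
    proof -
      have "(\<lambda>\<omega>. (fst (P k \<omega>), snd (P k \<omega>))) \<in> borel_measurable M"
        using P[of k] by (intro borel_measurable_Pair) (auto dest: square_integrableD)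
      then show ?thesis by simp
    qed
    then show "nesterov_position G s \<beta> (law M X) (Suc k) = law M (x k)" for k
      using P[of "Suc k"] by (simp add: nesterov_position_def distr_distr comp_def x_def[abs_def] del: nesterov.simps)
    show "w (Suc k) = (\<lambda>\<omega>. x (Suc k) \<omega> - x k \<omega>)" for k
      by (rule ext) (simp add: x_eq[of "Suc k"], simp add: x_def)
    show "x (Suc k) = (\<lambda>\<omega>. x k \<omega> + \<beta> (Suc k) *\<^sub>R w k \<omega>
      - s *\<^sub>R G (law M (\<lambda>\<omega>. x k \<omega> + \<beta> (Suc k) *\<^sub>R w k \<omega>)) (x k \<omega> + \<beta> (Suc k) *\<^sub>R w k \<omega>))" for k
      by (rule ext) (simp add: x_eq[of "Suc k"] w_Suc, simp add: x_def)
  qed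
qed

end

section \<open>Growth of the parameters and the convergence rates\<close>

text \<open>The recursion selects the larger root of the quadratic equation that makes the energies
  in the convex case telescope.\<close>

lemma kappa_Suc_squared: "(\<kappa> (Suc k))\<^sup>2 - \<kappa> (Suc k) = (\<kappa> k)\<^sup>2"
proof -
  have "(sqrt (1 + 4 * (\<kappa> k)\<^sup>2))\<^sup>2 = 1 + 4 * (\<kappa> k)\<^sup>2" by simp
  then show ?thesis by (simp add: power2_eq_square field_simps)
qed

text \<open>The square root in the recursion is at least \<open>2 * \<kappa> k\<close>, so every
  step adds at least 1/2. This linear growth is the source of the quadratic rate.\<close>

lemma kappa_ge: "(real k + 2) / 2 \<le> \<kappa> k"
proof (induction k)
  case (Suc k)
  have "2 * \<kappa> k = sqrt (4 * (\<kappa> k)\<^sup>2)" using Suc by (simp add: real_sqrt_mult)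
  also have "\<dots> \<le> sqrt (1 + 4 * (\<kappa> k)\<^sup>2)" by simp
  finally show ?case using Suc by simp
qed simp

context lipschitz_wasserstein_gradient
begin

text \<open>On the product space the first coordinate starts the iteration and the second is the
  comparison variable \<open>z\<close>, which never moves. The proof takes from the product measure
  only its two marginals. Positions 0 and 1 share the law of \<open>x 0\<close>.\<close>

lemma coupled_trajectory:
  fixes \<rho>\<^sub>0 \<rho>s :: "'a measure" and \<beta> :: "nat \<Rightarrow> real" and s :: real
  assumes \<rho>0: "\<rho>\<^sub>0 \<in> P2" and \<rho>s: "\<rho>s \<in> P2" and s: "s \<ge> 0"
  obtains M :: "('a \<times> 'a) measure" and x w z where "prob_space M"
    "\<And>k. square_integrable M (x k)" "\<And>k. square_integrable M (w k)" "square_integrable M z"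
    "law M z = \<rho>s" "nesterov_position G s \<beta> \<rho>\<^sub>0 0 = law M (x 0)"
    "\<And>k. nesterov_position G s \<beta> \<rho>\<^sub>0 (Suc k) = law M (x k)"
    "\<And>k. x (Suc k) = (\<lambda>\<omega>. x k \<omega> + \<beta> (Suc k) *\<^sub>R w k \<omega>
      - s *\<^sub>R G (law M (\<lambda>\<omega>. x k \<omega> + \<beta> (Suc k) *\<^sub>R w k \<omega>)) (x k \<omega> + \<beta> (Suc k) *\<^sub>R w k \<omega>))"
    "\<And>k. w (Suc k) = (\<lambda>\<omega>. x (Suc k) \<omega> - x k \<omega>)"
proof -
  define M where "M = \<rho>\<^sub>0 \<Otimes>\<^sub>M \<rho>s"
  have p: "prob_space \<rho>\<^sub>0" "prob_space \<rho>s" and sets: "sets \<rho>\<^sub>0 = sets borel" "sets \<rho>s = sets borel"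
    using \<rho>0 \<rho>s by (auto simp: P2_def)
  interpret P: pair_prob_space \<rho>\<^sub>0 \<rho>s using p by (simp add: pair_prob_space_def pair_sigma_finite_def prob_space_imp_sigma_finite)
  have M: "prob_space M" unfolding M_def by (rule P.prob_space_axioms)
  have fs [measurable]: "fst \<in> borel_measurable M" "snd \<in> borel_measurable M"
    unfolding M_def using sets by (auto simp: measurable_cong_sets[OF refl sets(1)[symmetric]]
      measurable_cong_sets[OF refl sets(2)[symmetric]])
  have spaces: "space \<rho>\<^sub>0 = UNIV" "space \<rho>s = UNIV"
    using sets[THEN sets_eq_imp_space_eq] by auto
  have l1: "law M fst = \<rho>\<^sub>0"
  proof (rule measure_eqI)
    fix A assume "A \<in> sets (law M fst)"
    then have A: "A \<in> sets borel" by simp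
    have "emeasure (law M fst) A = emeasure M (fst -` A \<inter> space M)"
      using A by (intro emeasure_distr) auto
    also have "fst -` A \<inter> space M = A \<times> space \<rho>s" by (auto simp: M_def space_pair_measure spaces)
    also have "emeasure M \<dots> = emeasure \<rho>\<^sub>0 A * emeasure \<rho>s (space \<rho>s)"
      unfolding M_def using A sets by (intro P.M2.emeasure_pair_measure_Times) auto
    finally show "emeasure (law M fst) A = emeasure \<rho>\<^sub>0 A" by (simp add: P.M2.emeasure_space_1)
  qed (simp add: sets)
  have l2: "law M snd = \<rho>s"
  proof (rule measure_eqI)
    fix A assume "A \<in> sets (law M snd)"
    then have A: "A \<in> sets borel" by simp
    have "emeasure (law M snd) A = emeasure M (snd -` A \<inter> space M)"
      using A by (intro emeasure_distr) auto
    also have "snd -` A \<inter> space M = space \<rho>\<^sub>0 \<times> A" by (auto simp: M_def space_pair_measure spaces)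
    also have "emeasure M \<dots> = emeasure \<rho>\<^sub>0 (space \<rho>\<^sub>0) * emeasure \<rho>s A"
      unfolding M_def using A sets by (intro P.M2.emeasure_pair_measure_Times) auto
    finally show "emeasure (law M snd) A = emeasure \<rho>s A" by (simp add: P.M1.emeasure_space_1)
  qed (simp add: sets)
  have "square_integrable (law M fst) (\<lambda>x. x)" "square_integrable (law M snd) (\<lambda>x. x)"
    unfolding l1 l2 by (rule P2_square_integrable_id[OF \<rho>0] P2_square_integrable_id[OF \<rho>s])+
  then have sf: "square_integrable M fst" and ss: "square_integrable M snd"
    by (simp_all only: square_integrable_law_iff[OF fs(1)] square_integrable_law_iff[OF fs(2)]
        measurable_ident_sets[OF refl])
  obtain x w where xw: "\<And>k. square_integrable M (x k)" "\<And>k. square_integrable M (w k)"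
    "x 0 = fst" "\<And>k. nesterov_position G s \<beta> (law M fst) (Suc k) = law M (x k)"
    "\<And>k. x (Suc k) = (\<lambda>\<omega>. x k \<omega> + \<beta> (Suc k) *\<^sub>R w k \<omega>
      - s *\<^sub>R G (law M (\<lambda>\<omega>. x k \<omega> + \<beta> (Suc k) *\<^sub>R w k \<omega>)) (x k \<omega> + \<beta> (Suc k) *\<^sub>R w k \<omega>))"
    "\<And>k. w (Suc k) = (\<lambda>\<omega>. x (Suc k) \<omega> - x k \<omega>)"
    by (fact nesterov_trajectory[OF M sf s])
  have "nesterov_position G s \<beta> \<rho>\<^sub>0 0 = law M (x 0)"
    unfolding l1[symmetric] xw(3) nesterov_position_def nesterov.simps
      pair_return_eq_law[OF M fs(1)]
    by (subst distr_distr) (auto simp: comp_def)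
  from that[of M x w snd, OF M xw(1,2) ss l2 this xw(4)[unfolded l1] xw(5,6)] show ?thesis .
qed

lemma nesterov_strongly_convex_rate:
  assumes \<rho>0: "\<rho>\<^sub>0 \<in> P2" and \<rho>s: "\<rho>s \<in> P2" and min: "\<And>\<rho>. \<rho> \<in> P2 \<Longrightarrow> F \<rho>s \<le> F \<rho>"
    and "m > 0" and conv: "geodesically_convex m F"
  shows "\<exists>C\<ge>0. \<forall>k. F (nesterov_position G (1 / L) (\<beta>_strong m (1 / L)) \<rho>\<^sub>0 k) - F \<rho>s \<le> C * (1 - sqrt (m / L)) ^ k"
proof -
  define r where "r = sqrt (m / L)"
  have m: "m = L * r\<^sup>2" using \<open>m > 0\<close> L_pos by (simp add: r_def)
  \<comment> \<open>Strictness gives \<open>r < 1\<close>, so that division by \<open>1 - r\<close>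
    below is legitimate.\<close>
  have "m < L" using convexity_modulus_le[OF conv] L_pos by simp
  then have r: "0 < r" "r < 1" using \<open>m > 0\<close> L_pos by (auto simp: r_def)
  have \<beta>: "\<beta>_strong m (1 / L) k = (1 - r) / (1 + r)" for k by (simp add: \<beta>_strong_def r_def)
  have s: "1 / L \<ge> 0" using L_pos by simp
  let ?pos = "nesterov_position G (1 / L) (\<beta>_strong m (1 / L)) \<rho>\<^sub>0"
  obtain M :: "('a \<times> 'a) measure" and x w z where M: "prob_space M"
    and sx: "\<And>k. square_integrable M (x k)" and sw: "\<And>k. square_integrable M (w k)"
    and sz: "square_integrable M z" and z: "law M z = \<rho>s"
    and pos: "?pos 0 = law M (x 0)" "\<And>k. ?pos (Suc k) = law M (x k)"
    and x: "\<And>k. x (Suc k) = (\<lambda>\<omega>. x k \<omega> + \<beta>_strong m (1 / L) (Suc k) *\<^sub>R w k \<omega>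
      - (1 / L) *\<^sub>R G (law M (\<lambda>\<omega>. x k \<omega> + \<beta>_strong m (1 / L) (Suc k) *\<^sub>R w k \<omega>))
          (x k \<omega> + \<beta>_strong m (1 / L) (Suc k) *\<^sub>R w k \<omega>))"
    and w: "\<And>k. w (Suc k) = (\<lambda>\<omega>. x (Suc k) \<omega> - x k \<omega>)"
    by (fact coupled_trajectory[OF \<rho>0 \<rho>s s])
  define E where "E k = F (law M (x k)) - F \<rho>s
    + L * r\<^sup>2 / 2 * (\<integral>\<omega>. (norm (x k \<omega> + (1 / r - 1) *\<^sub>R w k \<omega> - z \<omega>))\<^sup>2 \<partial>M)" for k
  have "E (Suc k) \<le> (1 - r) * E k" for k
    using accelerated_step_strong[OF M sx[of k] sw[of k] sz conv[unfolded m] r(1) less_imp_le[OF r(2)]]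
    unfolding E_def w by (simp add: x[of k] \<beta> z)
  then have E: "E k \<le> (1 - r) ^ k * E 0" for k
  proof (induction k)
    case (Suc k)
    have "E (Suc k) \<le> (1 - r) * E k" by fact
    also have "\<dots> \<le> (1 - r) * ((1 - r) ^ k * E 0)" using Suc r by (intro mult_left_mono) auto
    finally show ?case by simp
  qed simp
  have le_E: "F (law M (x k)) - F \<rho>s \<le> E k" for k using L_pos by (simp add: E_def)
  have E0: "0 \<le> E 0" using le_E[of 0] min[OF law_in_P2[OF M sx[of 0]]] by simp
  show ?thesis
  \<comment> \<open>The position after step \<open>k\<close> is \<open>x (k - 1)\<close>, so one
    contraction factor is lost; dividing the initial energy by \<open>1 - r\<close> compensates for
    it.\<close>
  proof (intro exI[of _ "E 0 / (1 - r)"] conjI allI)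
    show "0 \<le> E 0 / (1 - r)" using E0 r by simp
    show "F (?pos k) - F \<rho>s \<le> E 0 / (1 - r) * (1 - sqrt (m / L)) ^ k" for k
    proof (cases k)
      case 0
      have "E 0 \<le> E 0 / (1 - r)" using E0 r by (simp add: field_simps)
      then show ?thesis using le_E[of 0] 0 pos(1) by simp
    next
      case (Suc j)
      then show ?thesis using le_E[of j] E[of j] r pos(2)[of j] by (simp add: r_def[symmetric] mult.commute)
    qed
  qed
qed

lemma nesterov_convex_rate:
  assumes \<rho>0: "\<rho>\<^sub>0 \<in> P2" and \<rho>s: "\<rho>s \<in> P2" and min: "\<And>\<rho>. \<rho> \<in> P2 \<Longrightarrow> F \<rho>s \<le> F \<rho>"
    and conv: "geodesically_convex 0 F"
  shows "\<exists>C\<ge>0. \<forall>k\<ge>1. F (nesterov_position G (1 / L) \<beta>_convex \<rho>\<^sub>0 k) - F \<rho>s \<le> C / (real k)\<^sup>2"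
proof -
  have s: "1 / L \<ge> 0" using L_pos by simp
  let ?pos = "nesterov_position G (1 / L) \<beta>_convex \<rho>\<^sub>0"
  obtain M :: "('a \<times> 'a) measure" and x w z where M: "prob_space M"
    and sx: "\<And>k. square_integrable M (x k)" and sw: "\<And>k. square_integrable M (w k)"
    and sz: "square_integrable M z" and z: "law M z = \<rho>s"
    and "?pos 0 = law M (x 0)" and pos: "\<And>k. ?pos (Suc k) = law M (x k)"
    and x: "\<And>k. x (Suc k) = (\<lambda>\<omega>. x k \<omega> + \<beta>_convex (Suc k) *\<^sub>R w k \<omega>
      - (1 / L) *\<^sub>R G (law M (\<lambda>\<omega>. x k \<omega> + \<beta>_convex (Suc k) *\<^sub>R w k \<omega>))
          (x k \<omega> + \<beta>_convex (Suc k) *\<^sub>R w k \<omega>))"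
    and w: "\<And>k. w (Suc k) = (\<lambda>\<omega>. x (Suc k) \<omega> - x k \<omega>)"
    by (fact coupled_trajectory[OF \<rho>0 \<rho>s s])
  \<comment> \<open>The move from \<open>x k\<close> to \<open>x (Suc k)\<close> uses
    \<open>\<beta>_convex (Suc k)\<close>, whose numerator is \<open>\<kappa> (Suc k) - 1\<close>;
    hence the weight of the gap at \<open>x k\<close> carries index \<open>Suc k\<close>.\<close>
  define E where "E k = (\<kappa> (Suc k))\<^sup>2 * (F (law M (x k)) - F \<rho>s)
    + L / 2 * (\<integral>\<omega>. (norm (x k \<omega> + (\<kappa> (Suc k) - 1) *\<^sub>R w k \<omega> - z \<omega>))\<^sup>2 \<partial>M)" for k
  have k1: "1 \<le> \<kappa> k" for k using kappa_ge[of k] by simp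
  have "E (Suc k) \<le> E k" for k
    using accelerated_step_convex[OF M sx[of k] sw[of k] sz conv k1[of "Suc (Suc k)"] kappa_Suc_squared[of "Suc k"]]
    unfolding E_def w by (simp add: x[of k] \<beta>_convex_def z del: \<kappa>.simps)
  then have E: "E k \<le> E 0" for k
    by (induction k) (auto intro: order_trans)
  have le_E: "(\<kappa> (Suc k))\<^sup>2 * (F (law M (x k)) - F \<rho>s) \<le> E k" for k using L_pos by (simp add: E_def)
  have gap: "0 \<le> F (law M (x k)) - F \<rho>s" for k using min[OF law_in_P2[OF M sx[of k]]] by simp
  have E0: "0 \<le> E 0" using le_E[of 0] gap[of 0] by (meson order_trans mult_nonneg_nonneg zero_le_power2)
  show ?thesis
  \<comment> \<open>The factor 4 is the inverse square of the 1/2 in the linear lower bound for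
    \<open>\<kappa>\<close>; for \<open>k = Suc j\<close> the weight of \<open>x j\<close> is at
    least the square of \<open>k / 2\<close>.\<close>
  proof (intro exI[of _ "4 * E 0"] conjI allI impI)
    show "0 \<le> 4 * E 0" using E0 by simp
    fix k :: nat assume "1 \<le> k"
    then obtain j where k: "k = Suc j" by (cases k) auto
    have "real k / 2 \<le> \<kappa> (Suc j)" using kappa_ge[of "Suc j"] k by simp
    then have "(real k / 2)\<^sup>2 \<le> (\<kappa> (Suc j))\<^sup>2" by (intro power_mono) auto
    then have "(real k / 2)\<^sup>2 * (F (law M (x j)) - F \<rho>s) \<le> (\<kappa> (Suc j))\<^sup>2 * (F (law M (x j)) - F \<rho>s)"
      using gap[of j] by (intro mult_right_mono) auto
    also have "\<dots> \<le> E 0" using le_E[of j] E[of j] by simp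
    finally show "F (?pos k) - F \<rho>s \<le> 4 * E 0 / (real k)\<^sup>2"
      using \<open>1 \<le> k\<close> unfolding k pos by (simp add: field_simps power_divide)
  qed
qed

end

theorem theorem3p2:
  fixes F :: "(real ^ 'd) measure \<Rightarrow> real"
    and G :: "(real ^ 'd) measure \<Rightarrow> real ^ 'd \<Rightarrow> real ^ 'd"
    and L m\<^sub>F :: real
    and \<rho>\<^sub>0 :: "(real ^ 'd) measure"
  assumes "L > 0"
    and "\<And>\<rho>. \<rho> \<in> P2 \<Longrightarrow> wasserstein_differentiable F \<rho>"
    and "\<And>\<rho>. \<rho> \<in> P2 \<Longrightarrow> is_wasserstein_gradient F \<rho> (G \<rho>)"
    and "\<And>\<rho> \<rho>' x y. \<rho> \<in> P2 \<Longrightarrow> \<rho>' \<in> P2 \<Longrightarrow>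
           norm (G \<rho> x - G \<rho>' y) \<le> L / 2 * (norm (x - y) + W2 \<rho> \<rho>')"
    and "\<exists>\<rho>\<in>P2. F \<rho> = m\<^sub>F"
    and "\<And>\<rho>. \<rho> \<in> P2 \<Longrightarrow> m\<^sub>F \<le> F \<rho>"
    and "\<rho>\<^sub>0 \<in> P2"
  shows "(\<forall>m>0. geodesically_convex m F \<longrightarrow>
            (\<exists>C\<ge>0. \<forall>k. F (nesterov_position G (1 / L) (\<beta>_strong m (1 / L)) \<rho>\<^sub>0 k) - m\<^sub>F
                          \<le> C * (1 - sqrt (m / L)) ^ k)) \<and>
         (geodesically_convex 0 F \<longrightarrow>
            (\<exists>C\<ge>0. \<forall>k\<ge>1. F (nesterov_position G (1 / L) \<beta>_convex \<rho>\<^sub>0 k) - m\<^sub>F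
                          \<le> C / (real k)\<^sup>2))"
proof -
  interpret lipschitz_wasserstein_gradient F G L
    using assms(1,3,4) by unfold_locales (auto simp: is_wasserstein_gradient_def)
  obtain \<rho>s where \<rho>s: "\<rho>s \<in> P2" "F \<rho>s = m\<^sub>F" using assms(5) by blast
  have min: "F \<rho>s \<le> F \<rho>" if "\<rho> \<in> P2" for \<rho> using assms(6)[OF that] \<rho>s(2) by simp
  show ?thesis
    using nesterov_strongly_convex_rate[OF assms(7) \<rho>s(1) min] nesterov_convex_rate[OF assms(7) \<rho>s(1) min]
    unfolding \<rho>s(2) by blast
qed

end
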